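(* Assume the Continuum Hypothesis. Then there exists a maximal almost disjoint family $\mathcal{F}$ of infinite subsets of $\mathbb{N}$ such that: (i) no sequence in $\ell_1(\mathbb{N})\subset C(K_\mathcal{F})^*$ is $w^*$-convergent to $\delta_\infty$; (ii) the Banach space $C(K_\mathcal{F})$ is not fully Mackey complete.
   Context: An almost disjoint family is an infinite family of pairwise almost disjoint infinite subsets of $\mathbb{N}$ (two sets are almost disjoint if their intersection is finite); it is maximal if it is maximal with respect to inclusion among almost disjoint families. $K_\mathcal{F}$ is the Stone space of the Boolean algebra generated by $\mathcal{F}$ and the finite subsets of $\mathbb{N}$; it decomposes as $K_\mathcal{F}=\mathbb{N}\cup\{u_N:N\in\mathcal{F}\}\cup\{\infty\}$, where points of $\mathbb{N}$ are isolated, basic neighbourhoods of $u_N$ are $\{u_N\}\cup(N\setminus F)$ with $F\subset\mathbb{N}$ finite, and basic neighbourhoods of $\infty$ are $K_\mathcal{F}\setminus\bigcup_{N\in\mathcal{F}_0}(\{u_N\}\cup N)$ with $\mathcal{F}_0\subset\mathcal{F}$ finite. $C(K_\mathcal{F})$ carries the supremum norm; $\delta_t\in C(K_\mathcal{F})^*$ is evaluation at $t$, and $\ell_1(\mathbb{N})$ is identified with the closed subspace of $C(K_\mathcal{F})^*$ consisting of the elements $\sum_{n}\lambda_n\delta_n$ with $\sum_n|\lambda_n|<\infty$. A subspace $Y\subset Z^*$ of the dual of a Banach space $Z$ is norming if $|||z|||=\sup\{z^*(z): z^*\in Y,\ \|z^*\|\le1\}$ is an equivalent norm on $Z$; $Z$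 is fully Mackey complete if $(Z,\mu(Z,Y))$ is complete for every norming and norm-closed subspace $Y\subset Z^*$, where $\mu(Z,Y)$ is the topology of uniform convergence on absolutely convex $w^*$-compact subsets of $Y$. *)

theory Defs
  imports "HOL-Analysis.Analysis" "HOL-Library.Equipollence"
begin

definition almost_disjoint_family :: "nat set set \<Rightarrow> bool" where
  "almost_disjoint_family F \<longleftrightarrow>
     infinite F \<and> (\<forall>N\<in>F. infinite N) \<and> (\<forall>A\<in>F. \<forall>B\<in>F. A \<noteq> B \<longrightarrow> finite (A \<inter> B))"

definition maximal_ad_family :: "nat set set \<Rightarrow> bool" where
  "maximal_ad_family F \<longleftrightarrow> almost_disjoint_family F \<and>
     (\<forall>G. almost_disjoint_family G \<and> F \<subseteq> G \<longrightarrow> G = F)"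

datatype kpt = Pt nat | Ult "nat set" | Infty

definition KF_carrier :: "nat set set \<Rightarrow> kpt set" where
  "KF_carrier F = range Pt \<union> Ult ` F \<union> {Infty}"

definition KF_nbhd :: "nat set set \<Rightarrow> kpt \<Rightarrow> kpt set \<Rightarrow> bool" where
  "KF_nbhd F x B \<longleftrightarrow>
     (\<exists>n. x = Pt n \<and> B = {Pt n}) \<or>
     (\<exists>N\<in>F. \<exists>E. finite E \<and> x = Ult N \<and> B = insert (Ult N) (Pt ` (N - E))) \<or>
     (\<exists>F0. F0 \<subseteq> F \<and> finite F0 \<and> x = Infty \<and>
        B = KF_carrier F - (\<Union>N\<in>F0. insert (Ult N) (Pt ` N)))"

definition KF :: "nat set set \<Rightarrow> kpt topology" where
  "KF F = topology (\<lambda>S. S \<subseteq> KF_carrier F \<and> (\<forall>x\<in>S. \<exists>B. KF_nbhd F x B \<and> B \<subseteq> S))"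

definition CK :: "nat set set \<Rightarrow> (kpt \<Rightarrow> real) set" where
  "CK F = {f. continuous_map (KF F) euclideanreal f \<and> (\<forall>x. x \<notin> KF_carrier F \<longrightarrow> f x = 0)}"

definition cnorm :: "nat set set \<Rightarrow> (kpt \<Rightarrow> real) \<Rightarrow> real" where
  "cnorm F f = (SUP x\<in>KF_carrier F. \<bar>f x\<bar>)"

definition dualC :: "nat set set \<Rightarrow> ((kpt \<Rightarrow> real) \<Rightarrow> real) set" where
  "dualC F = {\<phi> \<in> extensional (CK F).
     (\<forall>f\<in>CK F. \<forall>g\<in>CK F. \<forall>a b. \<phi> (\<lambda>x. a * f x + b * g x) = a * \<phi> f + b * \<phi> g) \<and>
     (\<exists>M. \<forall>f\<in>CK F. \<bar>\<phi> f\<bar> \<le> M * cnorm F f)}"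

definition dnorm :: "nat set set \<Rightarrow> ((kpt \<Rightarrow> real) \<Rightarrow> real) \<Rightarrow> real" where
  "dnorm F \<phi> = (SUP f\<in>{f\<in>CK F. cnorm F f \<le> 1}. \<bar>\<phi> f\<bar>)"

definition dlin :: "nat set set \<Rightarrow> real \<Rightarrow> ((kpt \<Rightarrow> real) \<Rightarrow> real) \<Rightarrow> real
                     \<Rightarrow> ((kpt \<Rightarrow> real) \<Rightarrow> real) \<Rightarrow> ((kpt \<Rightarrow> real) \<Rightarrow> real)" where
  "dlin F a \<phi> b \<psi> = restrict (\<lambda>f. a * \<phi> f + b * \<psi> f) (CK F)"

definition dual_subspace :: "nat set set \<Rightarrow> ((kpt \<Rightarrow> real) \<Rightarrow> real) set \<Rightarrow> bool" where
  "dual_subspace F Y \<longleftrightarrow> Y \<subseteq> dualC F \<and> Y \<noteq> {} \<and>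
     (\<forall>\<phi>\<in>Y. \<forall>\<psi>\<in>Y. \<forall>a b. dlin F a \<phi> b \<psi> \<in> Y)"

definition norm_closed :: "nat set set \<Rightarrow> ((kpt \<Rightarrow> real) \<Rightarrow> real) set \<Rightarrow> bool" where
  "norm_closed F Y \<longleftrightarrow> (\<forall>\<phi> s. \<phi> \<in> dualC F \<and> (\<forall>k. s k \<in> Y) \<and>
      (\<lambda>k. dnorm F (dlin F 1 (s k) (-1) \<phi>)) \<longlonglongrightarrow> 0 \<longrightarrow> \<phi> \<in> Y)"

definition tnorm :: "nat set set \<Rightarrow> ((kpt \<Rightarrow> real) \<Rightarrow> real) set \<Rightarrow> (kpt \<Rightarrow> real) \<Rightarrow> real" where
  "tnorm F Y z = (SUP \<phi>\<in>{\<phi>\<in>Y. dnorm F \<phi> \<le> 1}. \<phi> z)"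

definition norming :: "nat set set \<Rightarrow> ((kpt \<Rightarrow> real) \<Rightarrow> real) set \<Rightarrow> bool" where
  "norming F Y \<longleftrightarrow> (\<exists>c>0. \<exists>C>0. \<forall>z\<in>CK F.
      c * cnorm F z \<le> tnorm F Y z \<and> tnorm F Y z \<le> C * cnorm F z)"

definition weak_star :: "nat set set \<Rightarrow> ((kpt \<Rightarrow> real) \<Rightarrow> real) topology" where
  "weak_star F = subtopology (product_topology (\<lambda>_. euclideanreal) (CK F)) (dualC F)"

definition abs_convex :: "nat set set \<Rightarrow> ((kpt \<Rightarrow> real) \<Rightarrow> real) set \<Rightarrow> bool" where
  "abs_convex F W \<longleftrightarrow> (\<forall>\<phi>\<in>W. \<forall>\<psi>\<in>W. \<forall>a b. \<bar>a\<bar> + \<bar>b\<bar> \<le> 1 \<longrightarrow> dlin F a \<phi> b \<psi> \<in> W)"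

text \<open>Nonempty absolutely convex w*-compact subsets of Y (the empty set gives the zero seminorm).\<close>
definition mackey_sets :: "nat set set \<Rightarrow> ((kpt \<Rightarrow> real) \<Rightarrow> real) set \<Rightarrow> ((kpt \<Rightarrow> real) \<Rightarrow> real) set set" where
  "mackey_sets F Y = {W. W \<noteq> {} \<and> W \<subseteq> Y \<and> abs_convex F W \<and> compactin (weak_star F) W}"

definition mseminorm :: "((kpt \<Rightarrow> real) \<Rightarrow> real) set \<Rightarrow> (kpt \<Rightarrow> real) \<Rightarrow> real" where
  "mseminorm W z = (SUP \<phi>\<in>W. \<bar>\<phi> z\<bar>)"

definition mackey_complete :: "nat set set \<Rightarrow> ((kpt \<Rightarrow> real) \<Rightarrow> real) set \<Rightarrow> bool" where
  "mackey_complete F Y \<longleftrightarrow>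
    (\<forall>\<F> :: (kpt \<Rightarrow> real) filter.
       \<F> \<noteq> bot \<and> eventually (\<lambda>z. z \<in> CK F) \<F> \<and>
       (\<forall>W\<in>mackey_sets F Y. \<forall>\<epsilon>>0. \<exists>A. eventually (\<lambda>z. z \<in> A) \<F> \<and>
          (\<forall>x\<in>A. \<forall>y\<in>A. mseminorm W (\<lambda>t. x t - y t) < \<epsilon>))
       \<longrightarrow> (\<exists>z\<in>CK F. \<forall>W\<in>mackey_sets F Y. \<forall>\<epsilon>>0.
              eventually (\<lambda>x. mseminorm W (\<lambda>t. x t - z t) < \<epsilon>) \<F>))"

definition fully_mackey_complete :: "nat set set \<Rightarrow> bool" where
  "fully_mackey_complete F \<longleftrightarrow>
     (\<forall>Y. dual_subspace F Y \<and> norming F Y \<and> norm_closed F Y \<longrightarrow> mackey_complete F Y)"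

definition continuum_hypothesis :: bool where
  "continuum_hypothesis \<longleftrightarrow> (\<forall>A :: real set. countable A \<or> A \<approx> (UNIV :: real set))"

end

theory Submission
  imports Defs
begin

text \<open>
  Under CH the sequences in \<open>\<ell>\<^sub>1\<close> are listed so that each has countably many predecessors. A sequence
  converging weak* to \<open>\<delta>\<^sub>\<infinity>\<close> has total mass tending to 1 while its mass on every point and on every member of
  the family tends to 0; at each stage a gliding hump argument gives a new set, almost disjoint from the
  countably many old ones, on which the mass of the current sequence does not vanish in the limit. This property
  survives the extension to a maximal family.

  For the second part take \<open>Y = \<ell>\<^sub>1(\<nat> \<union> {\<infinity>})\<close> and let \<open>h\<close> be the coordinate at \<open>\<infinity>\<close>. It is not given by
  a continuous function, as \<open>\<nat>\<close> is dense, but by the first part it is weak* sequentially continuous on \<open>Y\<close>.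
  Weak* compact subsets of \<open>Y\<close> are metrizable, so \<open>h\<close> is continuous on absolutely convex weak* compact sets and
  hence, by Hahn--Banach, a limit of elements of \<open>C(K)\<close> uniformly on each of them. These approximations
  generate a Cauchy filter without a limit.
\<close>

section \<open>An almost disjoint family killing all sequences\<close>

definition mass :: "(nat \<Rightarrow> real) \<Rightarrow> nat set \<Rightarrow> real" where
  "mass a A = (\<Sum>n. a n * indicator A n)"

lemma summable_mult_bounded:
  fixes a g :: "nat \<Rightarrow> real"
  assumes "summable (\<lambda>n. \<bar>a n\<bar>)" "\<And>n. \<bar>g n\<bar> \<le> C"
  shows "summable (\<lambda>n. a n * g n)"
proof (rule summable_comparison_test'[where g = "\<lambda>n. C * \<bar>a n\<bar>" and N = 0])
  show "summable (\<lambda>n. C * \<bar>a n\<bar>)" using assms(1) by (rule summable_mult)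
  show "norm (a n * g n) \<le> C * \<bar>a n\<bar>" for n
    using mult_right_mono[OF assms(2)[of n], of "\<bar>a n\<bar>"] by (simp add: abs_mult mult.commute)
qed

lemma summable_mass: "summable (\<lambda>n. \<bar>a n\<bar>) \<Longrightarrow> summable (\<lambda>n. a n * indicator A n :: real)"
  by (rule summable_mult_bounded[where C = 1]) (auto simp: indicator_def)

lemma mass_Un_disjoint:
  assumes "summable (\<lambda>n. \<bar>a n\<bar>)" "A \<inter> B = {}"
  shows "mass a (A \<union> B) = mass a A + mass a B"
proof -
  have "a n * indicator (A \<union> B) n = a n * indicator A n + a n * indicator B n" for n
    using assms(2) by (auto simp: indicator_def)
  then show ?thesis
    unfolding mass_def using assms(1) by (simp add: suminf_add[symmetric] summable_mass)
qed

lemma mass_finite: "finite E \<Longrightarrow> mass a E = (\<Sum>n\<in>E. a n)"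
  unfolding mass_def by (subst suminf_finite[of E]) auto

lemma abs_mass_le:
  assumes "summable (\<lambda>n. \<bar>a n\<bar>)" "A \<subseteq> B"
  shows "\<bar>mass a A\<bar> \<le> mass (\<lambda>n. \<bar>a n\<bar>) B"
proof -
  have s: "summable (\<lambda>n. \<bar>a n * indicator A n\<bar>)" 
    using summable_mass[of "\<lambda>n. \<bar>a n\<bar>" A] assms(1) by (simp add: abs_mult)
  have "\<bar>mass a A\<bar> \<le> (\<Sum>n. \<bar>a n * indicator A n\<bar>)"
    unfolding mass_def using s by (rule summable_rabs)
  also have "\<dots> \<le> mass (\<lambda>n. \<bar>a n\<bar>) B"
    unfolding mass_def
    by (rule suminf_le) (use assms s summable_mass[of "\<lambda>n. \<bar>a n\<bar>" B] in \<open>auto simp: indicator_def\<close>)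
  finally show ?thesis .
qed

lemma mass_tail_tendsto_0:
  assumes "summable (\<lambda>n. \<bar>a n\<bar>)"
  shows "(\<lambda>q. mass (\<lambda>n. \<bar>a n\<bar>) {q..}) \<longlonglongrightarrow> 0"
proof -
  have "mass (\<lambda>n. \<bar>a n\<bar>) {q..} = (\<Sum>n. \<bar>a n\<bar>) - (\<Sum>n<q. \<bar>a n\<bar>)" for q
  proof -
    have "mass (\<lambda>n. \<bar>a n\<bar>) ({..<q} \<union> {q..}) = mass (\<lambda>n. \<bar>a n\<bar>) {..<q} + mass (\<lambda>n. \<bar>a n\<bar>) {q..}"
      using assms by (intro mass_Un_disjoint) auto
    moreover have "{..<q} \<union> {q..} = UNIV" by auto
    ultimately show ?thesis by (simp add: mass_finite) (simp add: mass_def)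
  qed
  moreover have "(\<lambda>q. (\<Sum>n. \<bar>a n\<bar>) - (\<Sum>n<q. \<bar>a n\<bar>)) \<longlonglongrightarrow> (\<Sum>n. \<bar>a n\<bar>) - (\<Sum>n. \<bar>a n\<bar>)"
    by (intro tendsto_intros summable_LIMSEQ assms)
  ultimately show ?thesis by simp
qed

text \<open>Inclusion-exclusion for masses. It is applied to sets with finite intersection, where
  the third hypothesis follows from pointwise convergence by
  \<open>mass_finite_null\<close>.\<close>

lemma mass_Un_null:
  assumes s: "\<And>k. summable (\<lambda>n. \<bar>lam k n\<bar>)"
    and A: "(\<lambda>k. mass (lam k) A) \<longlonglongrightarrow> 0" and B: "(\<lambda>k. mass (lam k) B) \<longlonglongrightarrow> 0"
    and AB: "(\<lambda>k. mass (lam k) (A \<inter> B)) \<longlonglongrightarrow> 0"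
  shows "(\<lambda>k. mass (lam k) (A \<union> B)) \<longlonglongrightarrow> 0"
proof -
  have "mass (lam k) (A \<union> B) = mass (lam k) A + mass (lam k) B - mass (lam k) (A \<inter> B)" for k
  proof -
    have "mass (lam k) (A \<union> (B - A)) = mass (lam k) A + mass (lam k) (B - A)"
      by (rule mass_Un_disjoint[OF s]) auto
    moreover have "mass (lam k) ((B - A) \<union> (A \<inter> B)) = mass (lam k) (B - A) + mass (lam k) (A \<inter> B)"
      by (rule mass_Un_disjoint[OF s]) auto
    moreover have "A \<union> (B - A) = A \<union> B" "(B - A) \<union> (A \<inter> B) = B" by auto
    ultimately show ?thesis by simp
  qed
  then show ?thesis using tendsto_diff[OF tendsto_add[OF A B] AB] by simp
qed

lemma mass_finite_null:
  assumes "\<And>n. (\<lambda>k. lam k n) \<longlonglongrightarrow> 0" "finite E"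
  shows "(\<lambda>k. mass (lam k) E) \<longlonglongrightarrow> 0"
  using assms(2) by (simp add: mass_finite) (intro tendsto_null_sum assms(1))

text \<open>
  Since the mass of \<open>lam k\<close> on finite unions of the \<open>M j\<close> and on initial segments vanishes in the limit,
  some \<open>lam k\<close> puts mass greater than 1/2 on a finite block avoiding both; \<open>N\<close> is the union of such
  blocks, the i-th one avoiding \<open>M 0, \<dots>, M i\<close>.
\<close>
lemma gliding_hump:
  fixes lam :: "nat \<Rightarrow> nat \<Rightarrow> real" and M :: "nat \<Rightarrow> nat set"
  assumes s: "\<And>k. summable (\<lambda>n. \<bar>lam k n\<bar>)"
    and pt: "\<And>n. (\<lambda>k. lam k n) \<longlonglongrightarrow> 0"
    and tot: "(\<lambda>k. \<Sum>n. lam k n) \<longlonglongrightarrow> 1"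
    and M: "\<And>j. (\<lambda>k. mass (lam k) (M j)) \<longlonglongrightarrow> 0"
    and ad: "\<And>i j. M i \<noteq> M j \<Longrightarrow> finite (M i \<inter> M j)"
  obtains N where "infinite N" "\<And>j. finite (N \<inter> M j)" "\<not> (\<lambda>k. mass (lam k) N) \<longlonglongrightarrow> 0"
proof -
  define U where "U i = (\<Union>j\<le>i. M j)" for i
  have U: "(\<lambda>k. mass (lam k) (U i)) \<longlonglongrightarrow> 0" for i
  proof (induction i)
    case 0
    then show ?case using M by (simp add: U_def)
  next
    case (Suc i)
    have eq: "U (Suc i) = U i \<union> M (Suc i)"
      by (auto simp: U_def le_Suc_eq)
    show ?case
    \<comment> \<open>The enumeration \<open>M\<close> may repeat sets, and \<open>ad\<close> speaks
      of distinct values only. A repeated set is absorbed by \<open>U i\<close>; a new one meets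
      \<open>U i\<close> in a finite set.\<close>
    proof (cases "\<exists>j\<le>i. M j = M (Suc i)")
      case True
      then have "U (Suc i) = U i" unfolding eq by (auto simp: U_def)
      then show ?thesis using Suc by simp
    next
      case False
      then have "finite (\<Union>j\<le>i. M j \<inter> M (Suc i))"
        using ad by blast
      moreover have "(\<Union>j\<le>i. M j \<inter> M (Suc i)) = U i \<inter> M (Suc i)" by (auto simp: U_def)
      ultimately have "finite (U i \<inter> M (Suc i))" by simp
      then show ?thesis unfolding eq
        by (intro mass_Un_null s Suc M mass_finite_null pt)
    qed
  qed
  define nu where "nu k = mass (\<lambda>n. \<bar>lam k n\<bar>)" for k
  define A where "A i p q = {p..<q} - U i" for i p q :: nat
  \<comment> \<open>The total exceeds 7/8; less than 1/8 is lost on \<open>U i\<close> together with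
    the initial segment and less than 1/8 in the tail, so the block carries more than 1/2. The two
    bounds on absolute masses later leave more than 1/4 for all of \<open>N\<close>.\<close>
  define good where "good i = (\<lambda>(k,p,q). p < q \<and> mass (lam k) (A i p q) > 1/2
      \<and> nu k {..<p} < 1/8 \<and> nu k {q..} < 1/8)" for i
  have step: "\<exists>k>K. \<exists>q. good i (k, p, q)" for i p K
  proof -
    have "(\<lambda>k. mass (lam k) (U i \<union> {..<p})) \<longlonglongrightarrow> 0"
      by (intro mass_Un_null s U mass_finite_null pt) auto
    then have 1: "\<forall>\<^sub>F k in sequentially. mass (lam k) (U i \<union> {..<p}) < 1/8"
      by (rule order_tendstoD) simp
    have "(\<lambda>k. nu k {..<p}) \<longlonglongrightarrow> 0"
      unfolding nu_def by (intro mass_finite_null tendsto_rabs_zero pt) auto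
    then have 2: "\<forall>\<^sub>F k in sequentially. nu k {..<p} < 1/8"
      by (rule order_tendstoD) simp
    have 3: "\<forall>\<^sub>F k in sequentially. (\<Sum>n. lam k n) > 7/8"
      using tot by (rule order_tendstoD) simp
    have "\<forall>\<^sub>F k in sequentially. k > K \<and> mass (lam k) (U i \<union> {..<p}) < 1/8 \<and>
        nu k {..<p} < 1/8 \<and> (\<Sum>n. lam k n) > 7/8"
      using eventually_gt_at_top[of K] 1 2 3 by eventually_elim simp
    then obtain k where k: "k > K" "mass (lam k) (U i \<union> {..<p}) < 1/8"
        "nu k {..<p} < 1/8" "(\<Sum>n. lam k n) > 7/8"
      unfolding eventually_sequentially by blast
    have "\<forall>\<^sub>F q in sequentially. nu k {q..} < 1/8"
      unfolding nu_def using mass_tail_tendsto_0[OF s] by (rule order_tendstoD) simp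
    then have "\<forall>\<^sub>F q in sequentially. q > p \<and> nu k {q..} < 1/8"
      using eventually_gt_at_top[of p] by eventually_elim simp
    then obtain q where q: "p < q" "nu k {q..} < 1/8"
      unfolding eventually_sequentially by blast
    have "mass (lam k) ((U i \<union> {..<p}) \<union> (A i p q \<union> ({q..} - U i))) =
        mass (lam k) (U i \<union> {..<p}) + (mass (lam k) (A i p q) + mass (lam k) ({q..} - U i))"
      using q by (subst mass_Un_disjoint[OF s], force simp: A_def, subst mass_Un_disjoint[OF s])
        (auto simp: A_def)
    moreover have "(U i \<union> {..<p}) \<union> (A i p q \<union> ({q..} - U i)) = UNIV"
      by (auto simp: A_def)
    moreover have "\<bar>mass (lam k) ({q..} - U i)\<bar> \<le> nu k {q..}"
      unfolding nu_def by (rule abs_mass_le[OF s]) auto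
    ultimately have "mass (lam k) (A i p q) > 1/2"
      using k q by (simp add: mass_def)
    then show ?thesis using k q unfolding good_def by auto
  qed
  \<comment> \<open>Dependent choice of windows: each starts where its predecessor ends, so they are
    adjacent, and the indices \<open>k\<close> increase strictly.\<close>
  have "\<exists>f. \<forall>i. good i (f i) \<and>
      (fst (f i) < fst (f (Suc i)) \<and> fst (snd (f (Suc i))) = snd (snd (f i)))"
    using step by (intro dependent_nat_choice) (fastforce)+
  then obtain f where f: "\<And>i. good i (f i)" "\<And>i. fst (f i) < fst (f (Suc i))"
      "\<And>i. fst (snd (f (Suc i))) = snd (snd (f i))" by blast
  define k p where "k i = fst (f i)" and "p i = fst (snd (f i))" for i
  have fi: "f i = (k i, p i, p (Suc i))" for i
    using f(3)[of i] by (simp add: k_def p_def prod_eq_iff)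
  define B where "B i = A i (p i) (p (Suc i))" for i
  have k: "strict_mono k" using f(2) by (simp add: k_def strict_mono_Suc_iff)
  have g: "p i < p (Suc i)" "mass (lam (k i)) (B i) > 1/2" "nu (k i) {..<p i} < 1/8"
      "nu (k i) {p (Suc i)..} < 1/8" for i
    using f(1)[of i] by (auto simp: good_def fi B_def)
  have p: "strict_mono p" using g(1) by (simp add: strict_mono_Suc_iff)
  have Bsub: "B i \<subseteq> {p i..<p (Suc i)}" for i by (auto simp: B_def A_def)
  define N where "N = (\<Union>i. B i)"
  have Ncut: "N \<inter> {p i..<p (Suc i)} = B i" for i
  proof -
    have "j = i" if "n \<in> B j" "n \<in> {p i..<p (Suc i)}" for j n
    proof (rule ccontr)
      assume "j \<noteq> i"
      then consider "Suc j \<le> i" | "Suc i \<le> j" by linarith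
      then show False
      proof cases
        case 1
        then have "p (Suc j) \<le> p i" using strict_mono_less_eq[OF p] by blast
        moreover have "n < p (Suc j)" "p i \<le> n" using that Bsub[of j] by auto
        ultimately show False by simp
      next
        case 2
        then have "p (Suc i) \<le> p j" using strict_mono_less_eq[OF p] by blast
        moreover have "p j \<le> n" "n < p (Suc i)" using that Bsub[of j] by auto
        ultimately show False by simp
      qed
    qed
    then show ?thesis using Bsub[of i] unfolding N_def by blast
  qed
  have big: "mass (lam (k i)) N > 1/4" for i
  proof -
    let ?a = "lam (k i)"
    have "mass ?a ((N \<inter> {..<p i}) \<union> (B i \<union> (N \<inter> {p (Suc i)..}))) =
        mass ?a (N \<inter> {..<p i}) + (mass ?a (B i) + mass ?a (N \<inter> {p (Suc i)..}))"
      using Bsub[of i] g(1)[of i]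
      by (subst mass_Un_disjoint[OF s], force, subst mass_Un_disjoint[OF s]) auto
    moreover have "(N \<inter> {..<p i}) \<union> (B i \<union> (N \<inter> {p (Suc i)..})) = N"
    proof -
      have "{..<p i} \<union> ({p i..<p (Suc i)} \<union> {p (Suc i)..}) = UNIV" using g(1)[of i] by auto
      then show ?thesis unfolding Ncut[symmetric] by (simp flip: Int_Un_distrib)
    qed
    moreover have "\<bar>mass ?a (N \<inter> {..<p i})\<bar> \<le> nu (k i) {..<p i}"
      "\<bar>mass ?a (N \<inter> {p (Suc i)..})\<bar> \<le> nu (k i) {p (Suc i)..}"
      unfolding nu_def by (rule abs_mass_le[OF s]; auto)+
    ultimately show ?thesis using g(2,3,4)[of i] by simp
  qed
  show thesis
  proof
    show "infinite N"
    proof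
      assume "finite N"
      then obtain m where m: "\<forall>n\<in>N. n \<le> m"
        unfolding finite_nat_set_iff_bounded_le ..
      have "B (Suc m) \<noteq> {}" using g(2)[of "Suc m"] by (auto simp: mass_def)
      then obtain n where "n \<in> B (Suc m)" by blast
      then have "n \<in> N" "n \<ge> p (Suc m)" using Bsub[of "Suc m"] by (auto simp: N_def)
      moreover have "p (Suc m) \<ge> Suc m" using p by (rule strict_mono_imp_increasing)
      ultimately show False using m by fastforce
    qed
    show "finite (N \<inter> M j)" for j
    proof (rule finite_subset)
      \<comment> \<open>For \<open>i \<ge> j\<close> the block \<open>B i\<close> avoids
        \<open>U i\<close>, which contains \<open>M j\<close>; only the finitely many earlier blocks
        can meet \<open>M j\<close>.\<close>
      show "N \<inter> M j \<subseteq> (\<Union>i<j. B i)"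
      proof
        fix n assume n: "n \<in> N \<inter> M j"
        then obtain i where i: "n \<in> B i" by (auto simp: N_def)
        then have "\<not> j \<le> i" using n by (auto simp: B_def A_def U_def)
        then show "n \<in> (\<Union>i<j. B i)" using i by auto
      qed
      show "finite (\<Union>i<j. B i)" by (auto simp: B_def A_def)
    qed
    show "\<not> (\<lambda>k. mass (lam k) N) \<longlonglongrightarrow> 0"
    proof
      assume "(\<lambda>k. mass (lam k) N) \<longlonglongrightarrow> 0"
      then have "\<forall>\<^sub>F k in sequentially. mass (lam k) N < 1/4" by (rule order_tendstoD) simp
      then obtain K where "\<And>k. k \<ge> K \<Longrightarrow> mass (lam k) N < 1/4"
        unfolding eventually_sequentially by blast
      moreover have "k K \<ge> K" using k by (rule strict_mono_imp_increasing)
      ultimately show False using big[of K] by fastforce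
    qed
  qed
qed

section \<open>Transfinite construction of the family under the Continuum Hypothesis\<close>

lemma real_sequences_lepoll_real: "(UNIV :: (nat \<Rightarrow> nat \<Rightarrow> real) set) \<lesssim> (UNIV :: real set)"
proof -
  obtain c :: "real \<Rightarrow> nat set" where c: "inj c"
    using nat_sets_eqpoll_reals eqpoll_sym eqpoll_imp_lepoll unfolding lepoll_def by blast
  \<comment> \<open>Each real is coded by a set of naturals, and the codes of all entries are stored
    side by side in one set through the pairing function; the section at \<open>(k, n)\<close>
    recovers the entry.\<close>
  define e where "e a = {prod_encode (prod_encode (k, n), m) | k n m. m \<in> c (a k n)}"
    for a :: "nat \<Rightarrow> nat \<Rightarrow> real"
  have "inj e"
  proof (rule injI, intro ext)
    fix a b :: "nat \<Rightarrow> nat \<Rightarrow> real" and k n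
    assume "e a = e b"
    moreover have "c (x k n) = {m. prod_encode (prod_encode (k, n), m) \<in> e x}" for x
      by (auto simp: e_def)
    ultimately show "a k n = b k n" using injD[OF c] by metis
  qed
  then have "(UNIV :: (nat \<Rightarrow> nat \<Rightarrow> real) set) \<lesssim> (UNIV :: nat set set)"
    unfolding lepoll_def by blast
  then show ?thesis using nat_sets_eqpoll_reals by (rule lepoll_trans2)
qed

text \<open>Proper initial segments of the cardinal order of the reals are not equipollent to the
  reals, hence countable under the Continuum Hypothesis. The order is pulled back along an injection
  into the reals.\<close>

lemma CH_imp_countable_segments:
  assumes ch: "continuum_hypothesis" and le: "(UNIV :: 'a set) \<lesssim> (UNIV :: real set)"
  obtains R :: "('a \<times> 'a) set" where "wf R" "\<And>x. countable {y. (y, x) \<in> R}"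
    "\<And>x y. x \<noteq> y \<Longrightarrow> (x, y) \<in> R \<or> (y, x) \<in> R"
proof -
  obtain g :: "'a \<Rightarrow> real" where g: "inj g" using le unfolding lepoll_def by blast
  define r where "r = card_of (UNIV :: real set)"
  have co: "Card_order r" and F: "Field r = UNIV"
    unfolding r_def by (rule card_of_Card_order, rule Field_card_of)
  then have wo: "Well_order r" by (simp add: card_order_on_def)
  have cs: "countable (underS r a)" for a
  proof (rule ccontr)
    assume "uncountable (underS r a)"
    then have "underS r a \<approx> (UNIV :: real set)" using ch by (auto simp: continuum_hypothesis_def)
    then have "(card_of (underS r a), r) \<in> ordIso" by (simp add: eqpoll_iff_card_of_ordIso r_def)
    then show False using card_of_underS[OF co, of a] F not_ordLess_ordIso by blast
  qed
  show thesis
  proof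
    show "wf (inv_image (r - Id) g)" using wo by (simp add: well_order_on_def)
    show "(x, y) \<in> inv_image (r - Id) g \<or> (y, x) \<in> inv_image (r - Id) g" if "x \<noteq> y" for x y
      using wo that F injD[OF g, of x y]
      by (auto simp: well_order_on_def linear_order_on_def total_on_def inv_image_def)
    show "countable {y. (y, x) \<in> inv_image (r - Id) g}" for x
    proof (rule countable_image_inj_on)
      show "inj_on g {y. (y, x) \<in> inv_image (r - Id) g}" using g inj_on_subset by blast
      show "countable (g ` {y. (y, x) \<in> inv_image (r - Id) g})"
        by (rule countable_subset[OF _ cs[of "g x"]]) (auto simp: underS_def)
    qed
  qed
qed

text \<open>Weak* convergence to evaluation at infinity, tested only on the unit functions, the
  constant one and the indicators of members of \<open>G\<close>. The condition becomes stronger as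
  \<open>G\<close> grows, so its failure passes to larger families.\<close>

definition tends_to_infty :: "(nat \<Rightarrow> nat \<Rightarrow> real) \<Rightarrow> nat set set \<Rightarrow> bool" where
  "tends_to_infty lam G \<longleftrightarrow> (\<forall>k. summable (\<lambda>n. \<bar>lam k n\<bar>)) \<and> (\<forall>n. (\<lambda>k. lam k n) \<longlonglongrightarrow> 0) \<and>
     (\<lambda>k. \<Sum>n. lam k n) \<longlonglongrightarrow> 1 \<and> (\<forall>N\<in>G. (\<lambda>k. mass (lam k) N) \<longlonglongrightarrow> 0)"

text \<open>Recursion along \<open>R\<close>, whose stages are the sequences themselves. The family
  available at a stage is countable, so \<open>gliding_hump\<close> applies whenever the sequence of
  that stage still tends to infinity with respect to it.\<close>

lemma exists_ad_family_killing_sequences: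
  assumes ch: "continuum_hypothesis"
  obtains G where "almost_disjoint_family G" "\<Union>G = UNIV" "\<And>lam. \<not> tends_to_infty lam G"
proof -
  obtain R :: "((nat \<Rightarrow> nat \<Rightarrow> real) \<times> (nat \<Rightarrow> nat \<Rightarrow> real)) set" where
    wf: "wf R" and cR: "\<And>x. countable {y. (y, x) \<in> R}"
    and tR: "\<And>x y. x \<noteq> y \<Longrightarrow> (x, y) \<in> R \<or> (y, x) \<in> R"
    using CH_imp_countable_segments[OF ch real_sequences_lepoll_real] by blast
  \<comment> \<open>A partition of the naturals into infinitely many infinite sets, taken as
    starting family: it makes the final family infinite and covering, and every
    \<open>old f x\<close> nonempty.\<close>
  define D where "D i = range (\<lambda>n. prod_encode (i, n))" for i
  have Dinf: "infinite (D i)" for i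
    unfolding D_def by (rule range_inj_infinite) (auto simp: inj_def)
  have Ddisj: "D i \<inter> D j = {}" if "i \<noteq> j" for i j using that by (auto simp: D_def)
  have Dinj: "inj D"
    using Dinf Ddisj by (metis Int_absorb finite.emptyI injI)
  have Dcov: "(\<Union>i. D i) = UNIV"
  proof -
    have "n \<in> D (fst (prod_decode n))" for n
      unfolding D_def by (rule image_eqI[where x = "snd (prod_decode n)"]) auto
    then show ?thesis by blast
  qed
  define old where "old f x = range D \<union> (f ` {y. (y, x) \<in> R} - {{}})"
    for f :: "(nat \<Rightarrow> nat \<Rightarrow> real) \<Rightarrow> nat set" and x
  \<comment> \<open>The empty set marks a stage at which nothing is added; \<open>old\<close> and
    the final family discard it.\<close>
  define P where "P f x N \<longleftrightarrow> (if tends_to_infty x (old f x)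
      then infinite N \<and> (\<forall>A\<in>old f x. finite (N \<inter> A)) \<and> \<not> (\<lambda>k. mass (x k) N) \<longlonglongrightarrow> 0
      else N = {})" for f x N
  have Pinf: "f y = {} \<or> infinite (f y) \<and> (\<forall>A\<in>old f y. finite (f y \<inter> A))"
    if "P f y (f y)" for f y
    using that by (auto simp: P_def split: if_splits)
  \<comment> \<open>Two distinct stages are comparable under \<open>R\<close>, and the set of the
    later one was chosen almost disjoint from that of the earlier one.\<close>
  have pair: "finite (f y \<inter> f z)"
    if P: "P f y (f y)" "P f z (f z)" and "f y \<noteq> f z" for f y z
  proof -
    have *: "finite (f y \<inter> f z)" if "(z, y) \<in> R" "P f y (f y)" for y z
      using Pinf[OF that(2)] that(1) by (cases "f z = {}") (auto simp: old_def)
    from \<open>f y \<noteq> f z\<close> have "y \<noteq> z" by auto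
    with tR consider "(z, y) \<in> R" | "(y, z) \<in> R" by blast
    then show ?thesis using *[OF _ P(1), of z] *[OF _ P(2), of y] by cases (auto simp: Int_commute)
  qed
  have base: "finite (f y \<inter> D i)" if "P f y (f y)" for f y i
    using Pinf[OF that] by (auto simp: old_def)
  have ad_aux: "finite (A \<inter> B)"
    if "\<And>y. y \<in> Z \<Longrightarrow> P f y (f y)" and AB: "A \<in> range D \<union> (f ` Z - {{}})"
      "B \<in> range D \<union> (f ` Z - {{}})" and "A \<noteq> B"
    for Z f A B
  proof -
    consider i j where "A = D i" "B = D j" | i y where "A = D i" "B = f y" "y \<in> Z"
      | i y where "B = D i" "A = f y" "y \<in> Z" | y z where "A = f y" "y \<in> Z" "B = f z" "z \<in> Z"
      using AB by blast
    then show ?thesis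
    proof cases
      case 1
      then show ?thesis using Ddisj \<open>A \<noteq> B\<close> by (metis finite.emptyI)
    next
      case 2
      then show ?thesis using base that(1) by (metis Int_commute)
    next
      case 3
      then show ?thesis using base that(1) by metis
    next
      case 4
      then show ?thesis using pair that(1,4) by metis
    qed
  qed
  have "\<exists>f. \<forall>x. P f x (f x)"
  \<comment> \<open>The recursion is legitimate because \<open>old f x\<close>, and with it
    \<open>P f x\<close>, depends only on the values of \<open>f\<close> below
    \<open>x\<close>.\<close>
  proof (rule dependent_wf_choice[OF wf])
    fix f g :: "(nat \<Rightarrow> nat \<Rightarrow> real) \<Rightarrow> nat set" and x N
    assume "\<And>z. (z, x) \<in> R \<Longrightarrow> f z = g z"
    then have "old f x = old g x" by (auto simp: old_def)
    then show "P f x N = P g x N" by (simp add: P_def)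
  next
    fix x f assume IH: "\<And>y. (y, x) \<in> R \<Longrightarrow> P f y (f y)"
    show "\<exists>N. P f x N"
    proof (cases "tends_to_infty x (old f x)")
      case True
      have "countable (old f x)" "old f x \<noteq> {}" using cR by (auto simp: old_def)
      then have M: "range (from_nat_into (old f x)) = old f x"
        by (simp add: range_from_nat_into)
      define M where "M = from_nat_into (old f x)"
      note M = M[folded M_def]
      have ad: "finite (A \<inter> B)" if "A \<in> old f x" "B \<in> old f x" "A \<noteq> B" for A B
        using ad_aux[of "{y. (y, x) \<in> R}" f A B] that IH by (auto simp: old_def)
      obtain N where "infinite N" "\<And>j. finite (N \<inter> M j)" "\<not> (\<lambda>k. mass (x k) N) \<longlonglongrightarrow> 0"
      proof (rule gliding_hump[of x M])
        show "(\<lambda>k. mass (x k) (M j)) \<longlonglongrightarrow> 0" for j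
          using True M by (auto simp: tends_to_infty_def)
        show "finite (M i \<inter> M j)" if "M i \<noteq> M j" for i j
          using ad M that by blast
      qed (use True in \<open>auto simp: tends_to_infty_def\<close>)
      then have "P f x N" using True by (simp add: P_def flip: M)
      then show ?thesis ..
    qed (auto simp: P_def)
  qed
  then obtain f where f: "\<And>x. P f x (f x)" by blast
  define G where "G = range D \<union> (range f - {{}})"
  show thesis
  proof
    show "\<Union>G = UNIV" using Dcov by (auto simp: G_def)
    have "infinite (range D)" using Dinj by (rule range_inj_infinite)
    moreover have "infinite N" if "N \<in> G" for N
      using that Pinf[OF f] Dinf by (auto simp: G_def)
    moreover have "finite (A \<inter> B)" if "A \<in> G" "B \<in> G" "A \<noteq> B" for A B
      using ad_aux[of UNIV f A B] that f by (auto simp: G_def)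
    ultimately show "almost_disjoint_family G"
      unfolding almost_disjoint_family_def by (auto simp: G_def)
    show "\<not> tends_to_infty lam G" for lam
    proof
      assume t: "tends_to_infty lam G"
      \<comment> \<open>The sequence \<open>lam\<close> was treated at its own stage: convergence on
        \<open>G\<close> includes convergence on \<open>old f lam\<close>, so a set spoiling it was
        added there.\<close>
      then have "tends_to_infty lam (old f lam)"
        by (auto simp: tends_to_infty_def G_def old_def)
      with f[of lam] have "infinite (f lam)" "\<not> (\<lambda>k. mass (lam k) (f lam)) \<longlonglongrightarrow> 0"
        by (auto simp: P_def)
      moreover have "f lam \<in> G" using \<open>infinite (f lam)\<close> by (auto simp: G_def)
      ultimately show False using t by (auto simp: tends_to_infty_def)
    qed
  qed
qed

lemma maximal_ad_extension:
  assumes "almost_disjoint_family G"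
  obtains F where "maximal_ad_family F" "G \<subseteq> F"
proof -
  let ?A = "{H. almost_disjoint_family H \<and> G \<subseteq> H}"
  have "\<exists>M\<in>?A. \<forall>X\<in>?A. M \<subseteq> X \<longrightarrow> X = M"
  proof (rule subset_Zorn_nonempty)
    show "?A \<noteq> {}" using assms by auto
    fix C assume C: "C \<noteq> {}" "subset.chain ?A C"
    have "finite (A \<inter> B)" if "X \<in> C" "Y \<in> C" "A \<in> X" "B \<in> Y" "A \<noteq> B" for A B X Y
    proof -
      have "X \<subseteq> Y \<or> Y \<subseteq> X" using C that by (auto simp: subset_chain_def)
      moreover have "almost_disjoint_family X" "almost_disjoint_family Y"
        using C that by (auto simp: subset_chain_def)
      ultimately show ?thesis using that unfolding almost_disjoint_family_def by (meson subsetD)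
    qed
    moreover have "infinite (\<Union>C)"
    proof -
      obtain X where "X \<in> C" using C by blast
      then have "infinite X" "X \<subseteq> \<Union>C" using C by (auto simp: subset_chain_def almost_disjoint_family_def)
      then show ?thesis using finite_subset by blast
    qed
    moreover have "infinite N" if "N \<in> \<Union>C" for N
      using that C by (auto simp: subset_chain_def almost_disjoint_family_def)
    moreover have "G \<subseteq> \<Union>C" using C by (fastforce simp: subset_chain_def)
    ultimately show "\<Union>C \<in> ?A" by (auto simp: almost_disjoint_family_def)
  qed
  then obtain F where F: "F \<in> ?A" and max: "\<forall>X\<in>?A. F \<subseteq> X \<longrightarrow> X = F" ..
  have "maximal_ad_family F" unfolding maximal_ad_family_def
  proof (intro conjI allI impI)
    show "almost_disjoint_family F" using F by simp
    show "X = F" if "almost_disjoint_family X \<and> F \<subseteq> X" for X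
      using max that F by blast
  qed
  then show thesis using that F by simp
qed

section \<open>The space of continuous functions and its dual\<close>

lemma KF_nbhd_simps [simp]:
  "KF_nbhd F (Pt n) B \<longleftrightarrow> B = {Pt n}"
  "KF_nbhd F (Ult N) B \<longleftrightarrow> N \<in> F \<and> (\<exists>E. finite E \<and> B = insert (Ult N) (Pt ` (N - E)))"
  "KF_nbhd F Infty B \<longleftrightarrow> (\<exists>F0. F0 \<subseteq> F \<and> finite F0 \<and>
     B = KF_carrier F - (\<Union>N\<in>F0. insert (Ult N) (Pt ` N)))"
  by (auto simp: KF_nbhd_def)

lemma KF_nbhd_UltI:
  "N \<in> F \<Longrightarrow> finite E \<Longrightarrow> KF_nbhd F (Ult N) (insert (Ult N) (Pt ` (N - E)))"
  by (auto simp: KF_nbhd_def)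

lemma KF_nbhd_InftyI:
  "F0 \<subseteq> F \<Longrightarrow> finite F0 \<Longrightarrow>
    KF_nbhd F Infty (KF_carrier F - (\<Union>N\<in>F0. insert (Ult N) (Pt ` N)))"
  by (auto simp: KF_nbhd_def)

lemma KF_nbhd_Int:
  assumes "KF_nbhd F x B" "KF_nbhd F x C"
  shows "\<exists>D. KF_nbhd F x D \<and> D \<subseteq> B \<inter> C"
proof (cases x)
  case (Pt n)
  then show ?thesis using assms by auto
next
  case (Ult N)
  then obtain E E' where "finite E" "B = insert (Ult N) (Pt ` (N - E))" "N \<in> F"
    "finite E'" "C = insert (Ult N) (Pt ` (N - E'))" using assms by auto
  then show ?thesis unfolding Ult
    by (intro exI[of _ "insert (Ult N) (Pt ` (N - (E \<union> E')))"] conjI KF_nbhd_UltI) auto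
next
  case Infty
  then obtain F0 F1 where
    "F0 \<subseteq> F" "finite F0" "B = KF_carrier F - (\<Union>N\<in>F0. insert (Ult N) (Pt ` N))"
    "F1 \<subseteq> F" "finite F1" "C = KF_carrier F - (\<Union>N\<in>F1. insert (Ult N) (Pt ` N))"
    using assms by auto
  then show ?thesis unfolding Infty
    by (intro exI[of _ "KF_carrier F - (\<Union>N\<in>F0 \<union> F1. insert (Ult N) (Pt ` N))"] conjI KF_nbhd_InftyI) auto
qed

lemma KF_nbhd_subset: "KF_nbhd F x B \<Longrightarrow> B \<subseteq> KF_carrier F"
  by (cases x) (auto simp: KF_carrier_def)

lemma KF_nbhd_ex: "x \<in> KF_carrier F \<Longrightarrow> \<exists>B. KF_nbhd F x B"
  by (cases x) (auto simp: KF_carrier_def)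

text \<open>\<open>topology\<close> returns the given predicate only once it is known to satisfy
  \<open>istopology\<close>; closure under intersections is \<open>KF_nbhd_Int\<close>.\<close>

lemma openin_KF:
  "openin (KF F) S \<longleftrightarrow> S \<subseteq> KF_carrier F \<and> (\<forall>x\<in>S. \<exists>B. KF_nbhd F x B \<and> B \<subseteq> S)"
proof -
  have "istopology (\<lambda>S. S \<subseteq> KF_carrier F \<and> (\<forall>x\<in>S. \<exists>B. KF_nbhd F x B \<and> B \<subseteq> S))"
    unfolding istopology_def
  proof (intro conjI allI impI ballI)
    fix S T x
    assume S: "S \<subseteq> KF_carrier F \<and> (\<forall>x\<in>S. \<exists>B. KF_nbhd F x B \<and> B \<subseteq> S)"
      and T: "T \<subseteq> KF_carrier F \<and> (\<forall>x\<in>T. \<exists>B. KF_nbhd F x B \<and> B \<subseteq> T)"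
    then show "S \<inter> T \<subseteq> KF_carrier F" by blast
    assume "x \<in> S \<inter> T"
    then obtain B C where "KF_nbhd F x B" "B \<subseteq> S" "KF_nbhd F x C" "C \<subseteq> T"
      using S T by (meson IntE)
    then show "\<exists>B. KF_nbhd F x B \<and> B \<subseteq> S \<inter> T"
      using KF_nbhd_Int[of F x B C] by blast
  next
    fix K x
    assume K: "\<forall>S\<in>K. S \<subseteq> KF_carrier F \<and> (\<forall>x\<in>S. \<exists>B. KF_nbhd F x B \<and> B \<subseteq> S)"
    then show "\<Union>K \<subseteq> KF_carrier F" by blast
    assume "x \<in> \<Union>K"
    then obtain S where "S \<in> K" "x \<in> S" by blast
    with K obtain B where "KF_nbhd F x B" "B \<subseteq> S" by blast
    with \<open>S \<in> K\<close> show "\<exists>B. KF_nbhd F x B \<and> B \<subseteq> \<Union>K" by blast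
  qed
  then show ?thesis by (simp add: KF_def topology_inverse')
qed

lemma topspace_KF [simp]: "topspace (KF F) = KF_carrier F"
proof -
  have "openin (KF F) (KF_carrier F)"
    unfolding openin_KF
  proof (intro conjI ballI subset_refl)
    fix x assume "x \<in> KF_carrier F"
    then obtain B where "KF_nbhd F x B" using KF_nbhd_ex by blast
    then show "\<exists>B. KF_nbhd F x B \<and> B \<subseteq> KF_carrier F" using KF_nbhd_subset by blast
  qed
  then have "KF_carrier F \<subseteq> topspace (KF F)" by (rule openin_subset)
  moreover have "topspace (KF F) \<subseteq> KF_carrier F"
    using openin_topspace[of "KF F"] unfolding openin_KF by simp
  ultimately show ?thesis by (rule antisym[rotated])
qed

lemma CK_nbhd:
  assumes "f \<in> CK F" "x \<in> KF_carrier F" "e > 0"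
  shows "\<exists>B. KF_nbhd F x B \<and> (\<forall>y\<in>B. \<bar>f y - f x\<bar> < e)"
proof -
  have "openin (KF F) {y \<in> topspace (KF F). f y \<in> ball (f x) e}"
    by (rule openin_continuous_map_preimage[where Y = euclideanreal])
      (use assms in \<open>auto simp: CK_def\<close>)
  moreover have "x \<in> {y \<in> topspace (KF F). f y \<in> ball (f x) e}" using assms by simp
  ultimately obtain B where "KF_nbhd F x B" "B \<subseteq> {y \<in> topspace (KF F). f y \<in> ball (f x) e}"
    unfolding openin_KF by blast
  then show ?thesis by (intro exI[of _ B]) (auto simp: dist_real_def abs_minus_commute)
qed

text \<open>Continuity of the constant one, of the unit functions and of the indicators of members
  is obtained from this criterion.\<close>

lemma CK_locally_constant:
  assumes "\<And>x. x \<notin> KF_carrier F \<Longrightarrow> f x = 0"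
    "\<And>x. x \<in> KF_carrier F \<Longrightarrow> \<exists>B. KF_nbhd F x B \<and> (\<forall>y\<in>B. f y = f x)"
  shows "f \<in> CK F"
proof -
  have "openin (KF F) {y \<in> KF_carrier F. f y \<in> U}" for U
    unfolding openin_KF
  proof (intro conjI ballI)
    fix x assume "x \<in> {y \<in> KF_carrier F. f y \<in> U}"
    then obtain B where "KF_nbhd F x B" "\<forall>y\<in>B. f y = f x" "f x \<in> U"
      using assms(2) by blast
    then show "\<exists>B. KF_nbhd F x B \<and> B \<subseteq> {y \<in> KF_carrier F. f y \<in> U}"
      using KF_nbhd_subset by fastforce
  qed auto
  then show ?thesis using assms(1) by (simp add: CK_def continuous_map_def)
qed

lemma CK_lin: "f \<in> CK F \<Longrightarrow> g \<in> CK F \<Longrightarrow> (\<lambda>x. a * f x + b * g x) \<in> CK F"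
  unfolding CK_def by (auto intro!: continuous_intros)

lemma CK_diff: "f \<in> CK F \<Longrightarrow> g \<in> CK F \<Longrightarrow> (\<lambda>x. f x - g x) \<in> CK F"
  using CK_lin[of f F g 1 "-1"] by simp

lemma CK_zero [simp]: "(\<lambda>x. 0) \<in> CK F"
  by (simp add: CK_def)

lemma Pt_in_carrier [simp]: "Pt n \<in> KF_carrier F" and Infty_in_carrier [simp]: "Infty \<in> KF_carrier F"
  by (auto simp: KF_carrier_def)

lemma CK_bounded:
  assumes "f \<in> CK F"
  shows "bounded (f ` KF_carrier F)"
proof -
  have bnd: "\<exists>B. KF_nbhd F x B \<and> bounded (f ` B)" if "x \<in> KF_carrier F" for x
  proof -
    from CK_nbhd[OF assms that zero_less_one]
    obtain B where "KF_nbhd F x B" "\<forall>y\<in>B. \<bar>f y - f x\<bar> < 1" by blast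
    moreover from this have "f ` B \<subseteq> ball (f x) 1" by (auto simp: dist_real_def abs_minus_commute)
    ultimately show ?thesis using bounded_ball bounded_subset by blast
  qed
  obtain F0 where F0: "F0 \<subseteq> F" "finite F0"
    "bounded (f ` (KF_carrier F - (\<Union>N\<in>F0. insert (Ult N) (Pt ` N))))"
  proof -
    from bnd[OF Infty_in_carrier] obtain B where "KF_nbhd F Infty B" "bounded (f ` B)" by blast
    then show thesis using that unfolding KF_nbhd_simps by blast
  qed
  have "bounded (f ` insert (Ult N) (Pt ` N))" if N: "N \<in> F0" for N
  proof -
    obtain E where "finite E" "bounded (f ` insert (Ult N) (Pt ` (N - E)))"
    proof -
      have "N \<in> F" using F0 N by blast
      then have "Ult N \<in> KF_carrier F" by (simp add: KF_carrier_def)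
      from bnd[OF this] obtain B where "KF_nbhd F (Ult N) B" "bounded (f ` B)" by blast
      then show thesis using that unfolding KF_nbhd_simps by blast
    qed
    then have "bounded (f ` (insert (Ult N) (Pt ` (N - E)) \<union> Pt ` E))"
      unfolding image_Un bounded_Un by (blast intro: finite_imp_bounded finite_imageI)
    then show ?thesis by (rule bounded_subset) (rule image_mono, blast)
  qed
  then have "bounded (\<Union>N\<in>F0. f ` insert (Ult N) (Pt ` N))"
    using F0(2) by (intro bounded_UN ballI)
  then have "bounded (f ` ((KF_carrier F - (\<Union>N\<in>F0. insert (Ult N) (Pt ` N))) \<union>
      (\<Union>N\<in>F0. insert (Ult N) (Pt ` N))))"
    using F0(3) unfolding image_Un image_UN bounded_Un by blast
  then show ?thesis by (rule bounded_subset) (rule image_mono, blast)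
qed

lemma abs_le_cnorm:
  assumes "f \<in> CK F" "x \<in> KF_carrier F"
  shows "\<bar>f x\<bar> \<le> cnorm F f"
proof -
  obtain C where "\<forall>x\<in>KF_carrier F. \<bar>f x\<bar> \<le> C"
    using CK_bounded[OF assms(1)] by (auto simp: bounded_iff)
  then have "bdd_above ((\<lambda>x. \<bar>f x\<bar>) ` KF_carrier F)" by (auto simp: bdd_above_def)
  then show ?thesis unfolding cnorm_def by (rule cSUP_upper[OF assms(2)])
qed

lemma cnorm_nonneg: "f \<in> CK F \<Longrightarrow> 0 \<le> cnorm F f"
  using abs_le_cnorm[of f F Infty] by simp

lemma cnorm_le: "(\<And>x. x \<in> KF_carrier F \<Longrightarrow> \<bar>f x\<bar> \<le> C) \<Longrightarrow> cnorm F f \<le> C"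
  unfolding cnorm_def by (rule cSUP_least) (auto intro: Infty_in_carrier)

section \<open>Bounded linear functionals and their norms\<close>

lemma dualCI:
  assumes "\<phi> \<in> extensional (CK F)"
    and "\<And>f g a b. f \<in> CK F \<Longrightarrow> g \<in> CK F \<Longrightarrow> \<phi> (\<lambda>x. a * f x + b * g x) = a * \<phi> f + b * \<phi> g"
    and "\<And>f. f \<in> CK F \<Longrightarrow> \<bar>\<phi> f\<bar> \<le> M * cnorm F f"
  shows "\<phi> \<in> dualC F"
  unfolding dualC_def mem_Collect_eq by (intro conjI ballI allI exI[of _ M] assms)

lemma dualC_lin:
  "\<phi> \<in> dualC F \<Longrightarrow> f \<in> CK F \<Longrightarrow> g \<in> CK F \<Longrightarrow> \<phi> (\<lambda>x. a * f x + b * g x) = a * \<phi> f + b * \<phi> g"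
  by (simp add: dualC_def)

lemma dualC_diff:
  "\<phi> \<in> dualC F \<Longrightarrow> f \<in> CK F \<Longrightarrow> g \<in> CK F \<Longrightarrow> \<phi> (\<lambda>x. f x - g x) = \<phi> f - \<phi> g"
  using dualC_lin[of \<phi> F f g 1 "-1"] by simp

lemma dualC_sum:
  fixes u :: "nat \<Rightarrow> kpt \<Rightarrow> real"
  assumes "\<phi> \<in> dualC F" "\<And>i. u i \<in> CK F"
  shows "(\<lambda>x. \<Sum>i<m. c i * u i x) \<in> CK F" "\<phi> (\<lambda>x. \<Sum>i<m. c i * u i x) = (\<Sum>i<m. c i * \<phi> (u i))"
proof (induction m)
  case 0
  show "(\<lambda>x. \<Sum>i<0. c i * u i x) \<in> CK F" by simp
  show "\<phi> (\<lambda>x. \<Sum>i<0. c i * u i x) = (\<Sum>i<0. c i * \<phi> (u i))"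
    using dualC_lin[OF assms(1) CK_zero CK_zero, of 0 0] by simp
next
  case (Suc m)
  show "(\<lambda>x. \<Sum>i<Suc m. c i * u i x) \<in> CK F"
    using CK_lin[OF Suc(1) assms(2)[of m], of 1 "c m"] by simp
  show "\<phi> (\<lambda>x. \<Sum>i<Suc m. c i * u i x) = (\<Sum>i<Suc m. c i * \<phi> (u i))"
    using dualC_lin[OF assms(1) Suc(1) assms(2)[of m], of 1 "c m"] Suc(2) by simp
qed

lemma dualC_bound:
  assumes "\<phi> \<in> dualC F" "f \<in> CK F"
  shows "\<bar>\<phi> f\<bar> \<le> dnorm F \<phi> * cnorm F f"
proof -
  obtain M where M: "\<And>f. f \<in> CK F \<Longrightarrow> \<bar>\<phi> f\<bar> \<le> M * cnorm F f"
    using assms(1) unfolding dualC_def by blast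
  show ?thesis
  proof (cases "cnorm F f = 0")
    case True
    then show ?thesis using M[OF assms(2)] by simp
  next
    case False
    then have pos: "cnorm F f > 0" using cnorm_nonneg[OF assms(2)] by simp
    \<comment> \<open>The normalised function; the summand \<open>0 * f x\<close> puts it into the
      shape required by \<open>CK_lin\<close> and \<open>dualC_lin\<close>.\<close>
    define g where "g = (\<lambda>x. (1 / cnorm F f) * f x + 0 * f x)"
    have g: "g \<in> CK F" unfolding g_def by (intro CK_lin assms)
    have "cnorm F g \<le> 1"
      by (rule cnorm_le) (use abs_le_cnorm[OF assms(2)] pos in \<open>simp add: g_def\<close>)
    moreover have "bdd_above ((\<lambda>f. \<bar>\<phi> f\<bar>) ` {f \<in> CK F. cnorm F f \<le> 1})"
    proof (rule bdd_aboveI2)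
      fix f assume f: "f \<in> {f \<in> CK F. cnorm F f \<le> 1}"
      then have "\<bar>\<phi> f\<bar> \<le> M * cnorm F f" using M by simp
      also have "\<dots> \<le> \<bar>M\<bar> * 1" using f cnorm_nonneg by (intro mult_mono) auto
      finally show "\<bar>\<phi> f\<bar> \<le> \<bar>M\<bar>" by simp
    qed
    ultimately have "\<bar>\<phi> g\<bar> \<le> dnorm F \<phi>"
      unfolding dnorm_def using g by (intro cSUP_upper) auto
    moreover have "\<phi> g = \<phi> f / cnorm F f"
      unfolding g_def by (subst dualC_lin) (use assms in auto)
    ultimately show ?thesis using pos by (simp add: field_simps abs_mult)
  qed
qed

lemma dnorm_le:
  assumes "\<And>f. f \<in> CK F \<Longrightarrow> \<bar>\<phi> f\<bar> \<le> C * cnorm F f" "C \<ge> 0"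
  shows "dnorm F \<phi> \<le> C"
  unfolding dnorm_def
proof (rule cSUP_least)
  have "cnorm F (\<lambda>x. 0) \<le> 1" by (rule cnorm_le) simp
  then show "{f \<in> CK F. cnorm F f \<le> 1} \<noteq> {}" using CK_zero by blast
  fix f assume f: "f \<in> {f \<in> CK F. cnorm F f \<le> 1}"
  then have "\<bar>\<phi> f\<bar> \<le> C * cnorm F f" using assms by blast
  also have "\<dots> \<le> C * 1" using f assms by (intro mult_left_mono) auto
  finally show "\<bar>\<phi> f\<bar> \<le> C" by simp
qed

lemma dlin_apply [simp]: "f \<in> CK F \<Longrightarrow> dlin F a \<phi> b \<psi> f = a * \<phi> f + b * \<psi> f"
  by (simp add: dlin_def)

lemma dlin_dualC:
  assumes "\<phi> \<in> dualC F" "\<psi> \<in> dualC F"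
  shows "dlin F a \<phi> b \<psi> \<in> dualC F"
proof (rule dualCI)
  fix f assume f: "f \<in> CK F"
  have "\<bar>a * \<phi> f + b * \<psi> f\<bar> \<le> \<bar>a\<bar> * \<bar>\<phi> f\<bar> + \<bar>b\<bar> * \<bar>\<psi> f\<bar>"
    using abs_triangle_ineq[of "a * \<phi> f" "b * \<psi> f"] by (simp add: abs_mult)
  also have "\<dots> \<le> \<bar>a\<bar> * (dnorm F \<phi> * cnorm F f) + \<bar>b\<bar> * (dnorm F \<psi> * cnorm F f)"
    using f assms by (intro add_mono mult_left_mono dualC_bound) auto
  finally show "\<bar>dlin F a \<phi> b \<psi> f\<bar> \<le> (\<bar>a\<bar> * dnorm F \<phi> + \<bar>b\<bar> * dnorm F \<psi>) * cnorm F f"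
    using f by (simp add: algebra_simps)
next
  show "dlin F a \<phi> b \<psi> \<in> extensional (CK F)" by (simp add: dlin_def)
next
  fix f g c d assume "f \<in> CK F" "g \<in> CK F"
  then show "dlin F a \<phi> b \<psi> (\<lambda>x. c * f x + d * g x) =
      c * dlin F a \<phi> b \<psi> f + d * dlin F a \<phi> b \<psi> g"
    by (simp add: CK_lin dualC_lin[OF assms(1)] dualC_lin[OF assms(2)] algebra_simps)
qed

text \<open>Scaled evaluation, restricted to \<open>CK F\<close> because members of
  \<open>dualC\<close> are extensional. With the scalar as a parameter, the segment of multiples of
  an evaluation is the image of an interval.\<close>

definition delta :: "nat set set \<Rightarrow> real \<Rightarrow> kpt \<Rightarrow> (kpt \<Rightarrow> real) \<Rightarrow> real" where
  "delta F t x = restrict (\<lambda>f. t * f x) (CK F)"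

lemma delta_apply [simp]: "f \<in> CK F \<Longrightarrow> delta F t x f = t * f x"
  by (simp add: delta_def)

lemma delta_dualC: 
  assumes "x \<in> KF_carrier F"
  shows "delta F t x \<in> dualC F"
proof (rule dualCI)
  show "\<bar>delta F t x f\<bar> \<le> \<bar>t\<bar> * cnorm F f" if "f \<in> CK F" for f
    using that abs_le_cnorm[OF that assms] by (simp add: abs_mult mult_left_mono)
  show "delta F t x \<in> extensional (CK F)" by (simp add: delta_def)
  show "delta F t x (\<lambda>y. a * f y + b * g y) = a * delta F t x f + b * delta F t x g"
    if "f \<in> CK F" "g \<in> CK F" for f g a b
    using that by (simp add: CK_lin algebra_simps)
qed

section \<open>Coefficients of a functional on the naturals and at infinity\<close>

definition unit_at :: "nat \<Rightarrow> kpt \<Rightarrow> real" where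
  "unit_at n = indicator {Pt n}"

text \<open>The constant one, cut off outside the carrier since members of \<open>CK F\<close>
  vanish there.\<close>

definition one_fun :: "nat set set \<Rightarrow> kpt \<Rightarrow> real" where
  "one_fun F = indicator (KF_carrier F)"

lemma one_fun_CK [simp]: "one_fun F \<in> CK F"
proof (rule CK_locally_constant)
  fix x assume x: "x \<in> KF_carrier F"
  then obtain B where B: "KF_nbhd F x B" using KF_nbhd_ex by blast
  have "one_fun F y = one_fun F x" if "y \<in> B" for y
    using KF_nbhd_subset[OF B] that x by (auto simp: one_fun_def)
  with B show "\<exists>B. KF_nbhd F x B \<and> (\<forall>y\<in>B. one_fun F y = one_fun F x)" by blast
qed (simp add: one_fun_def)

text \<open>
  Functionals are extensional, so \<open>ell1_infty\<close> below consists of the elements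
  \<open>\<Sum>n. \<lambda>\<^sub>n \<delta>\<^sub>n + c \<delta>\<^sub>\<infinity>\<close> with absolutely summable \<open>\<lambda>\<close>; the coefficients are recovered from the values on
  \<open>unit_at n\<close> and \<open>one_fun\<close>.
\<close>
definition infty_coord :: "nat set set \<Rightarrow> ((kpt \<Rightarrow> real) \<Rightarrow> real) \<Rightarrow> real" where
  "infty_coord F \<phi> = \<phi> (one_fun F) - (\<Sum>n. \<phi> (unit_at n))"

definition atomic_part :: "nat set set \<Rightarrow> ((kpt \<Rightarrow> real) \<Rightarrow> real) \<Rightarrow> (kpt \<Rightarrow> real) \<Rightarrow> real" where
  "atomic_part F \<phi> f = (\<Sum>n. \<phi> (unit_at n) * f (Pt n)) + infty_coord F \<phi> * f Infty"

definition ell1_infty :: "nat set set \<Rightarrow> ((kpt \<Rightarrow> real) \<Rightarrow> real) set" where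
  "ell1_infty F = {\<phi> \<in> dualC F. \<forall>f\<in>CK F. \<phi> f = atomic_part F \<phi> f}"

text \<open>
  The basic neighbourhoods of \<open>Infty\<close> only remove members of \<open>F\<close>, so a point of \<open>nat\<close> outside \<open>\<Union>F\<close>
  could not be separated from \<open>Infty\<close>.
\<close>
locale covering_ad_family =
  fixes F :: "nat set set"
  assumes ad: "almost_disjoint_family F" and cover: "\<Union>F = UNIV"
begin

text \<open>Density of the naturals. At infinity, some member \<open>M\<close> outside the finite
  set \<open>F0\<close> exists, and \<open>M\<close> meets each member of \<open>F0\<close> in a
  finite set, so infinitely many of its points survive.\<close>

lemma nbhd_meets_nat:
  assumes "KF_nbhd F x B"
  shows "\<exists>n. Pt n \<in> B"
proof (cases x)
  case (Pt n)
  then show ?thesis using assms by auto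
next
  case (Ult N)
  then obtain E where E: "N \<in> F" "finite E" "B = insert (Ult N) (Pt ` (N - E))"
    using assms by auto
  then have "infinite (N - E)" using ad by (simp add: almost_disjoint_family_def)
  then obtain n where "n \<in> N - E" using infinite_imp_nonempty by blast
  then show ?thesis using E by auto
next
  case Infty
  then obtain F0 where F0: "F0 \<subseteq> F" "finite F0" "B = KF_carrier F - (\<Union>N\<in>F0. insert (Ult N) (Pt ` N))"
    using assms by auto
  have "infinite (F - F0)" using ad F0 by (simp add: almost_disjoint_family_def)
  then obtain M where M: "M \<in> F" "M \<notin> F0" using infinite_imp_nonempty by blast
  have "finite (M \<inter> N)" if "N \<in> F0" for N
    using ad M F0 that unfolding almost_disjoint_family_def by (metis subsetD)
  then have "finite (\<Union>N\<in>F0. M \<inter> N)" using F0 by blast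
  then have "infinite (M - (\<Union>N\<in>F0. M \<inter> N))"
    using ad M by (simp add: almost_disjoint_family_def)
  then obtain n where "n \<in> M - (\<Union>N\<in>F0. M \<inter> N)" using infinite_imp_nonempty by blast
  then have "Pt n \<in> B" using F0 by auto
  then show ?thesis ..
qed

lemma abs_le_of_nat_points:
  assumes "f \<in> CK F" "\<And>n. \<bar>f (Pt n)\<bar> \<le> C" "x \<in> KF_carrier F"
  shows "\<bar>f x\<bar> \<le> C"
proof (rule field_le_epsilon)
  fix e :: real assume "e > 0"
  then obtain B where B: "KF_nbhd F x B" "\<forall>y\<in>B. \<bar>f y - f x\<bar> < e"
    using CK_nbhd[OF assms(1,3)] by blast
  then obtain n where "Pt n \<in> B" using nbhd_meets_nat by blast
  then have "\<bar>f (Pt n) - f x\<bar> < e" using B by blast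
  then show "\<bar>f x\<bar> \<le> C + e" using assms(2)[of n] by linarith
qed

lemma unit_at_CK [simp]: "unit_at n \<in> CK F"
proof (rule CK_locally_constant)
  fix x assume x: "x \<in> KF_carrier F"
  show "\<exists>B. KF_nbhd F x B \<and> (\<forall>y\<in>B. unit_at n y = unit_at n x)"
  proof (cases x)
    case (Ult N)
    then have "N \<in> F" using x by (auto simp: KF_carrier_def)
    then have "KF_nbhd F (Ult N) (insert (Ult N) (Pt ` (N - {n})))" by (rule KF_nbhd_UltI) simp
    moreover have "unit_at n y = unit_at n (Ult N)" if "y \<in> insert (Ult N) (Pt ` (N - {n}))" for y
    proof -
      have "y \<noteq> Pt n" using that by blast
      then show ?thesis by (simp add: unit_at_def)
    qed
    ultimately show ?thesis unfolding Ult by blast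
  next
    case Infty
    have "n \<in> \<Union>F" by (simp add: cover)
    then obtain N where N: "N \<in> F" "n \<in> N" by blast
    let ?B = "KF_carrier F - (\<Union>N\<in>{N}. insert (Ult N) (Pt ` N))"
    have "KF_nbhd F Infty ?B" by (rule KF_nbhd_InftyI) (use N in auto)
    moreover have "unit_at n y = unit_at n Infty" if "y \<in> ?B" for y
    proof -
      have "y \<noteq> Pt n" using that N by blast
      then show ?thesis by (simp add: unit_at_def)
    qed
    ultimately show ?thesis unfolding Infty by blast
  qed auto
qed (auto simp: unit_at_def indicator_def)

text \<open>The set is clopen: around \<open>Ult M\<close> with \<open>M \<noteq> N\<close> one
  removes the finite set \<open>M \<inter> N\<close>, around infinity the set itself.\<close>

lemma member_indicator_CK:
  assumes N: "N \<in> F"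
  shows "indicator (insert (Ult N) (Pt ` N)) \<in> CK F"
proof (rule CK_locally_constant)
  fix x assume x: "x \<in> KF_carrier F"
  let ?f = "indicator (insert (Ult N) (Pt ` N)) :: kpt \<Rightarrow> real"
  show "\<exists>B. KF_nbhd F x B \<and> (\<forall>y\<in>B. ?f y = ?f x)"
  proof (cases x)
    case (Ult M)
    then have M: "M \<in> F" using x by (auto simp: KF_carrier_def)
    show ?thesis
    proof (cases "M = N")
      case True
      then show ?thesis unfolding Ult using N
        by (intro exI[of _ "insert (Ult N) (Pt ` (N - {}))"] conjI KF_nbhd_UltI) (auto simp: indicator_def)
    next
      case False
      then have "finite (M \<inter> N)" using ad M N by (simp add: almost_disjoint_family_def)
      then show ?thesis unfolding Ult using M False
        by (intro exI[of _ "insert (Ult M) (Pt ` (M - (M \<inter> N)))"] conjI KF_nbhd_UltI) (auto simp: indicator_def)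
    qed
  next
    case Infty
    show ?thesis unfolding Infty using N
      by (intro exI[of _ "KF_carrier F - (\<Union>N\<in>{N}. insert (Ult N) (Pt ` N))"] conjI KF_nbhd_InftyI) (auto simp: indicator_def)
  qed auto
qed (use N in \<open>auto simp: KF_carrier_def indicator_def\<close>)

text \<open>The functional is tested on finite sums of unit functions with coefficients
  \<open>sgn (\<phi> (unit_at n))\<close>; such a sum has norm at most 1 and its value is the
  partial sum of the absolute coefficients.\<close>

lemma dualC_unit_summable:
  assumes "\<phi> \<in> dualC F"
  shows "summable (\<lambda>n. \<bar>\<phi> (unit_at n)\<bar>)" "(\<Sum>n. \<bar>\<phi> (unit_at n)\<bar>) \<le> dnorm F \<phi>"
proof -
  have le: "(\<Sum>n<m. \<bar>\<phi> (unit_at n)\<bar>) \<le> dnorm F \<phi>" for m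
  proof -
    let ?g = "\<lambda>x. \<Sum>n<m. sgn (\<phi> (unit_at n)) * unit_at n x"
    have g: "?g \<in> CK F" by (rule dualC_sum(1)[OF assms unit_at_CK])
    have "cnorm F ?g \<le> 1"
    proof (rule cnorm_le)
      fix x
      show "\<bar>?g x\<bar> \<le> 1"
      proof (cases x)
        case (Pt k)
        have "?g (Pt k) = (\<Sum>n<m. if n = k then sgn (\<phi> (unit_at n)) else 0)"
          by (intro sum.cong) (auto simp: unit_at_def indicator_def)
        then show ?thesis unfolding Pt by (simp add: abs_sgn_eq)
      qed (auto simp: unit_at_def)
    qed
    have d0: "0 \<le> dnorm F \<phi>"
      using dualC_bound[OF assms one_fun_CK] cnorm_nonneg[OF one_fun_CK]
        abs_le_cnorm[OF one_fun_CK, of Infty]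
      by (smt (verit) Infty_in_carrier indicator_simps(1) mult_neg_pos one_fun_def)
    have "(\<Sum>n<m. \<bar>\<phi> (unit_at n)\<bar>) = \<phi> ?g"
      by (subst dualC_sum(2)[OF assms unit_at_CK]) (simp add: abs_sgn mult.commute)
    also have "\<dots> \<le> dnorm F \<phi> * cnorm F ?g" using dualC_bound[OF assms g] by linarith
    also have "\<dots> \<le> dnorm F \<phi> * 1"
      using \<open>cnorm F ?g \<le> 1\<close> d0 by (rule mult_left_mono)
    finally show ?thesis by simp
  qed
  show s: "summable (\<lambda>n. \<bar>\<phi> (unit_at n)\<bar>)"
    by (rule summableI_nonneg_bounded[where x = "dnorm F \<phi>"]) (auto intro: le)
  show "(\<Sum>n. \<bar>\<phi> (unit_at n)\<bar>) \<le> dnorm F \<phi>"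
    using s le by (rule suminf_le_const)
qed

lemma dualC_atomic_summable:
  assumes "\<phi> \<in> dualC F" "f \<in> CK F"
  shows "summable (\<lambda>n. \<phi> (unit_at n) * f (Pt n))"
  by (rule summable_mult_bounded[where C = "cnorm F f"])
    (auto intro: dualC_unit_summable abs_le_cnorm assms)

lemma infty_coord_lin:
  assumes "\<phi> \<in> dualC F" "\<psi> \<in> dualC F"
  shows "infty_coord F (dlin F a \<phi> b \<psi>) = a * infty_coord F \<phi> + b * infty_coord F \<psi>"
proof -
  have "summable (\<lambda>n. \<phi> (unit_at n))" "summable (\<lambda>n. \<psi> (unit_at n))"
    using dualC_unit_summable(1)[OF assms(1)] dualC_unit_summable(1)[OF assms(2)]
    by (auto intro: summable_rabs_cancel)
  then show ?thesis
    by (simp add: infty_coord_def suminf_add[symmetric] suminf_mult summable_mult algebra_simps)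
qed

lemma atomic_part_lin:
  assumes "\<phi> \<in> dualC F" "\<psi> \<in> dualC F" "f \<in> CK F"
  shows "atomic_part F (dlin F a \<phi> b \<psi>) f = a * atomic_part F \<phi> f + b * atomic_part F \<psi> f"
proof -
  have s: "summable (\<lambda>n. \<phi> (unit_at n) * f (Pt n))" "summable (\<lambda>n. \<psi> (unit_at n) * f (Pt n))"
    using assms dualC_atomic_summable by auto
  have "(\<Sum>n. dlin F a \<phi> b \<psi> (unit_at n) * f (Pt n)) =
      (\<Sum>n. a * (\<phi> (unit_at n) * f (Pt n)) + b * (\<psi> (unit_at n) * f (Pt n)))"
    by (simp add: algebra_simps)
  also have "\<dots> = a * (\<Sum>n. \<phi> (unit_at n) * f (Pt n)) + b * (\<Sum>n. \<psi> (unit_at n) * f (Pt n))"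
    using s by (simp add: suminf_add[symmetric] suminf_mult summable_mult)
  finally show ?thesis
    using assms by (simp add: atomic_part_def infty_coord_lin algebra_simps)
qed

text \<open>The factor 3 consists of 1 for the series and 2 for the coordinate at infinity, itself a
  difference of two terms bounded by \<open>dnorm F \<phi>\<close>.\<close>

lemma atomic_part_bound:
  assumes "\<phi> \<in> dualC F" "f \<in> CK F"
  shows "\<bar>atomic_part F \<phi> f\<bar> \<le> 3 * dnorm F \<phi> * cnorm F f"
proof -
  have s: "summable (\<lambda>n. \<bar>\<phi> (unit_at n)\<bar>)" and le: "(\<Sum>n. \<bar>\<phi> (unit_at n)\<bar>) \<le> dnorm F \<phi>"
    using dualC_unit_summable[OF assms(1)] by auto
  have c0: "0 \<le> cnorm F f" using assms(2) by (rule cnorm_nonneg)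
  have sb: "summable (\<lambda>n. \<bar>\<phi> (unit_at n) * f (Pt n)\<bar>)"
    using summable_mult_bounded[of "\<lambda>n. \<bar>\<phi> (unit_at n)\<bar>" "\<lambda>n. \<bar>f (Pt n)\<bar>" "cnorm F f"] s
      abs_le_cnorm[OF assms(2)] by (simp add: abs_mult)
  have "\<bar>\<Sum>n. \<phi> (unit_at n) * f (Pt n)\<bar> \<le> (\<Sum>n. \<bar>\<phi> (unit_at n) * f (Pt n)\<bar>)"
    using sb by (rule summable_rabs)
  also have "\<dots> \<le> (\<Sum>n. \<bar>\<phi> (unit_at n)\<bar> * cnorm F f)"
    by (rule suminf_le)
      (use sb s abs_le_cnorm[OF assms(2)] in \<open>auto simp: abs_mult intro: mult_left_mono summable_mult2\<close>)
  also have "\<dots> = (\<Sum>n. \<bar>\<phi> (unit_at n)\<bar>) * cnorm F f" using s by (rule suminf_mult2[symmetric])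
  also have "\<dots> \<le> dnorm F \<phi> * cnorm F f" using le c0 by (rule mult_right_mono)
  finally have 1: "\<bar>\<Sum>n. \<phi> (unit_at n) * f (Pt n)\<bar> \<le> dnorm F \<phi> * cnorm F f" .
  have d0: "0 \<le> dnorm F \<phi>" using le suminf_nonneg[OF s] by simp
  have "cnorm F (one_fun F) \<le> 1" by (rule cnorm_le) (simp add: one_fun_def)
  then have "\<bar>\<phi> (one_fun F)\<bar> \<le> dnorm F \<phi> * 1"
    using dualC_bound[OF assms(1) one_fun_CK] d0 mult_left_mono by (meson order_trans)
  moreover have "\<bar>\<Sum>n. \<phi> (unit_at n)\<bar> \<le> dnorm F \<phi>" using summable_rabs[OF s] le by linarith
  ultimately have "\<bar>infty_coord F \<phi>\<bar> \<le> 2 * dnorm F \<phi>" unfolding infty_coord_def by linarith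
  then have "\<bar>infty_coord F \<phi> * f Infty\<bar> \<le> (2 * dnorm F \<phi>) * cnorm F f"
    unfolding abs_mult using abs_le_cnorm[OF assms(2)] c0 d0 by (intro mult_mono) auto
  then show ?thesis using 1 unfolding atomic_part_def by (simp add: algebra_simps)
qed

lemma delta_ell1_infty:
  assumes "x = Pt n \<or> x = Infty"
  shows "delta F t x \<in> ell1_infty F" "infty_coord F (delta F t x) = (if x = Infty then t else 0)"
proof -
  have x: "x \<in> KF_carrier F" using assms by auto
  have o: "one_fun F x = 1" using x by (simp add: one_fun_def)
  have *: "(\<Sum>k. delta F t x (unit_at k) * g k) = (if x = Infty then 0 else t * g n)" for g
  proof (cases "x = Infty")
    case True
    moreover have "unit_at k Infty = 0" for k by (simp add: unit_at_def)
    ultimately show ?thesis by simp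
  next
    case False
    then have x: "x = Pt n" using assms by simp
    have "unit_at k (Pt n) = (if k = n then 1 else 0)" for k
      by (simp add: unit_at_def)
    then show ?thesis unfolding x by (subst suminf_finite[of "{n}"]) auto
  qed
  show ic: "infty_coord F (delta F t x) = (if x = Infty then t else 0)"
    using *[of "\<lambda>_. 1"] o by (simp add: infty_coord_def)
  show "delta F t x \<in> ell1_infty F"
    using * assms delta_dualC[OF x] by (auto simp: ell1_infty_def atomic_part_def ic)
qed

end

section \<open>The Mackey topology of a norming subspace\<close>

lemma ell1_inftyD:
  assumes "\<phi> \<in> ell1_infty F"
  shows "\<phi> \<in> dualC F" "f \<in> CK F \<Longrightarrow> \<phi> f = atomic_part F \<phi> f"
  using assms unfolding ell1_infty_def by blast+

context covering_ad_family
begin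

lemma dual_subspace_ell1_infty: "dual_subspace F (ell1_infty F)"
  unfolding dual_subspace_def
proof (intro conjI ballI allI)
  show "ell1_infty F \<subseteq> dualC F" by (auto simp: ell1_infty_def)
  show "ell1_infty F \<noteq> {}" using delta_ell1_infty(1)[of Infty] by blast
  fix \<phi> \<psi> a b assume "\<phi> \<in> ell1_infty F" "\<psi> \<in> ell1_infty F"
  then show "dlin F a \<phi> b \<psi> \<in> ell1_infty F"
    by (simp add: ell1_infty_def dlin_dualC atomic_part_lin)
qed

text \<open>As the naturals are dense, the functionals plus or minus \<open>\<delta>_n\<close>
  already compute the supremum norm; both constants are 1.\<close>

lemma norming_ell1_infty: "norming F (ell1_infty F)"
proof -
  have d1: "dnorm F (delta F s x) \<le> 1" if "x \<in> KF_carrier F" "\<bar>s\<bar> = 1" for s x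
    by (rule dnorm_le) (use that abs_le_cnorm in \<open>auto simp: abs_mult\<close>)
  have bound: "\<phi> z \<le> cnorm F z" if "\<phi> \<in> {\<phi> \<in> ell1_infty F. dnorm F \<phi> \<le> 1}" "z \<in> CK F" for \<phi> z
  proof -
    have "\<phi> z \<le> dnorm F \<phi> * cnorm F z"
      using dualC_bound[of \<phi> F z] that by (auto simp: ell1_infty_def)
    also have "\<dots> \<le> 1 * cnorm F z" using that by (intro mult_right_mono cnorm_nonneg) auto
    finally show ?thesis by simp
  qed
  have upper: "tnorm F (ell1_infty F) z \<le> cnorm F z" if "z \<in> CK F" for z
    unfolding tnorm_def
  proof (rule cSUP_least)
    show "{\<phi> \<in> ell1_infty F. dnorm F \<phi> \<le> 1} \<noteq> {}"
      using delta_ell1_infty(1)[of Infty _ 1] d1[of Infty 1] by auto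
  qed (use bound that in auto)
  have lower: "cnorm F z \<le> tnorm F (ell1_infty F) z" if z: "z \<in> CK F" for z
  proof (rule cnorm_le, rule abs_le_of_nat_points[OF z])
    fix n
    define s :: real where "s = (if z (Pt n) \<ge> 0 then 1 else -1)"
    have "delta F s (Pt n) z \<le> tnorm F (ell1_infty F) z"
      unfolding tnorm_def
    proof (rule cSUP_upper)
      show "delta F s (Pt n) \<in> {\<phi> \<in> ell1_infty F. dnorm F \<phi> \<le> 1}"
        using delta_ell1_infty(1)[of "Pt n" n s] d1[of "Pt n" s] by (auto simp: s_def)
      show "bdd_above ((\<lambda>\<phi>. \<phi> z) ` {\<phi> \<in> ell1_infty F. dnorm F \<phi> \<le> 1})"
        using bound[OF _ z] by (rule bdd_aboveI2)
    qed
    then show "\<bar>z (Pt n)\<bar> \<le> tnorm F (ell1_infty F) z" using z by (auto simp: s_def split: if_splits)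
  qed
  show ?thesis unfolding norming_def
    by (rule exI[of _ 1], rule conjI, simp, rule exI[of _ 1]) (use upper lower in auto)
qed

text \<open>Both \<open>\<phi> f\<close> and \<open>atomic_part F \<phi> f\<close> are norm
  continuous in \<open>\<phi>\<close> and they agree along the sequence. The factor 4 is 3 from
  \<open>atomic_part_bound\<close> plus 1 from \<open>dualC_bound\<close>.\<close>

lemma norm_closed_ell1_infty: "norm_closed F (ell1_infty F)"
  unfolding norm_closed_def
proof (intro allI impI, elim conjE)
  fix \<phi> s
  assume \<phi>: "\<phi> \<in> dualC F" and s: "\<forall>k. s k \<in> ell1_infty F"
    and lim: "(\<lambda>k. dnorm F (dlin F 1 (s k) (- 1) \<phi>)) \<longlonglongrightarrow> 0"
  have sd: "s k \<in> dualC F" for k using s by (auto simp: ell1_infty_def)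
  have "\<phi> f = atomic_part F \<phi> f" if f: "f \<in> CK F" for f
  proof -
    have le: "\<bar>\<phi> f - atomic_part F \<phi> f\<bar> \<le> 4 * dnorm F (dlin F 1 (s k) (- 1) \<phi>) * cnorm F f" for k
    proof -
      let ?p = "dlin F 1 (s k) (- 1) \<phi>"
      have p: "?p \<in> dualC F" using sd \<phi> by (rule dlin_dualC)
      have "s k f = atomic_part F (s k) f" using s f ell1_inftyD(2) by blast
      then have "\<phi> f - atomic_part F \<phi> f = atomic_part F ?p f - ?p f"
        using f by (simp add: atomic_part_lin[OF sd \<phi> f])
      then show ?thesis
        using atomic_part_bound[OF p f] dualC_bound[OF p f] by linarith
    qed
    have "(\<lambda>k. 4 * dnorm F (dlin F 1 (s k) (- 1) \<phi>) * cnorm F f) \<longlonglongrightarrow> 4 * 0 * cnorm F f"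
      by (intro tendsto_intros lim)
    then have "\<bar>\<phi> f - atomic_part F \<phi> f\<bar> \<le> 4 * 0 * cnorm F f"
      by (rule LIMSEQ_le_const) (use le in blast)
    then show ?thesis by simp
  qed
  then show "\<phi> \<in> ell1_infty F" using \<phi> by (simp add: ell1_infty_def)
qed

end

section \<open>Weak* continuity and weak* compact sets\<close>

lemma topspace_weak_star: "topspace (weak_star F) = dualC F"
  by (auto simp: weak_star_def topspace_product_topology PiE_def dualC_def)

lemma continuous_map_eval:
  assumes "f \<in> CK F"
  shows "continuous_map (weak_star F) euclideanreal (\<lambda>\<phi>. \<phi> f)"
  unfolding weak_star_def using assms
  by (intro continuous_map_from_subtopology continuous_map_product_projection[where X = "\<lambda>_. euclideanreal"])

lemma continuous_map_into_weak_star: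
  assumes "\<And>x. x \<in> topspace X \<Longrightarrow> g x \<in> dualC F"
    and "\<And>f. f \<in> CK F \<Longrightarrow> continuous_map X euclideanreal (\<lambda>x. g x f)"
  shows "continuous_map X (weak_star F) g"
  unfolding weak_star_def
proof (rule continuous_map_into_subtopology)
  have "g x \<in> extensional (CK F)" if "x \<in> topspace X" for x
    using assms(1)[OF that] by (simp add: dualC_def)
  then show "continuous_map X (product_topology (\<lambda>_. euclideanreal) (CK F)) g"
    using assms(2) by (auto simp: continuous_map_componentwise)
qed (use assms(1) in auto)

lemma compactin_sum:
  assumes W: "compactin (weak_star F) W" and V: "compactin (weak_star F) V"
  shows "compactin (weak_star F) ((\<lambda>(\<phi>, \<psi>). dlin F 1 \<phi> 1 \<psi>) ` (W \<times> V))"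
proof (rule image_compactin)
  show "compactin (prod_topology (weak_star F) (weak_star F)) (W \<times> V)"
    using W V by (simp add: compactin_Times)
  have "continuous_map (prod_topology (weak_star F) (weak_star F)) euclideanreal (\<lambda>x. fst x f + snd x f)"
    if "f \<in> CK F" for f
    using continuous_map_compose[OF continuous_map_fst continuous_map_eval[OF that], of "weak_star F"]
      continuous_map_compose[OF continuous_map_snd continuous_map_eval[OF that], of "weak_star F"]
    by (intro continuous_map_add) (simp_all add: o_def)
  then show "continuous_map (prod_topology (weak_star F) (weak_star F)) (weak_star F) (\<lambda>(\<phi>, \<psi>). dlin F 1 \<phi> 1 \<psi>)"
    by (intro continuous_map_into_weak_star) (auto simp: topspace_weak_star dlin_dualC split_beta)
qed

lemma compactin_delta:
  assumes "x \<in> KF_carrier F"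
  shows "compactin (weak_star F) ((\<lambda>t. delta F t x) ` {-1..1})"
proof (rule image_compactin)
  show "compactin euclideanreal {-1..1}" by simp
  show "continuous_map euclideanreal (weak_star F) (\<lambda>t. delta F t x)"
    using assms by (intro continuous_map_into_weak_star) (auto simp: delta_dualC intro!: continuous_intros)
qed

section \<open>Approximating a linear function on an absolutely convex set by finitely many
  others\<close>

definition dlinear_on :: "nat set set \<Rightarrow> ((kpt \<Rightarrow> real) \<Rightarrow> real) set \<Rightarrow> (((kpt \<Rightarrow> real) \<Rightarrow> real) \<Rightarrow> real) \<Rightarrow> bool" where
  "dlinear_on F W h \<longleftrightarrow> (\<forall>\<phi>\<in>W. \<forall>\<psi>\<in>W. \<forall>a b. h (dlin F a \<phi> b \<psi>) = a * h \<phi> + b * h \<psi>)"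

text \<open>
  The one-dimensional step of the Hahn--Banach theorem: the admissible \<open>c\<close> form the intersection of the
  intervals \<open>[(h \<phi> - \<epsilon>) / g \<phi>, (h \<phi> + \<epsilon>) / g \<phi>]\<close> over \<open>g \<phi> > 0\<close>.
\<close>
lemma small_on_kernel_imp_close:
  assumes W: "abs_convex F W" and h: "dlinear_on F W h" and g: "dlinear_on F W g"
    and small: "\<And>\<phi>. \<phi> \<in> W \<Longrightarrow> g \<phi> = 0 \<Longrightarrow> \<bar>h \<phi>\<bar> \<le> \<epsilon>"
  shows "\<exists>c. \<forall>\<phi>\<in>W. \<bar>h \<phi> - c * g \<phi>\<bar> \<le> \<epsilon>"
proof (cases "\<exists>\<phi>\<in>W. g \<phi> > 0")
  case False
  have "g \<phi> = 0" if "\<phi> \<in> W" for \<phi>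
  proof -
    have "dlin F (-1) \<phi> 0 \<phi> \<in> W" using W that unfolding abs_convex_def by simp
    moreover have "g (dlin F (-1) \<phi> 0 \<phi>) = - g \<phi>" using g that by (simp add: dlinear_on_def)
    ultimately have "\<not> g \<phi> > 0" "\<not> - g \<phi> > 0" using False that by metis+
    then show ?thesis by linarith
  qed
  then show ?thesis using small by (intro exI[of _ 0]) simp
next
  case True
  define P where "P = {\<phi> \<in> W. g \<phi> > 0}"
  have cross: "(h \<nu> - \<epsilon>) / g \<nu> \<le> (h \<mu> + \<epsilon>) / g \<mu>" if "\<nu> \<in> P" "\<mu> \<in> P" for \<nu> \<mu>
  proof -
    have pos: "g \<nu> > 0" "g \<mu> > 0" and in_W: "\<nu> \<in> W" "\<mu> \<in> W" using that by (auto simp: P_def)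
    define s where "s = g \<nu> + g \<mu>"
    have s: "s > 0" using pos by (simp add: s_def)
    \<comment> \<open>The combination of the two functionals on which \<open>g\<close> vanishes.
      Dividing by \<open>s\<close> makes the absolute coefficients add up to 1, so it stays in
      \<open>W\<close> and \<open>small\<close> bounds \<open>h\<close> there.\<close>
    let ?w = "dlin F (g \<mu> / s) \<nu> (- (g \<nu> / s)) \<mu>"
    have "\<bar>g \<mu> / s\<bar> + \<bar>- (g \<nu> / s)\<bar> \<le> 1" using pos s by (simp add: s_def field_simps)
    then have "?w \<in> W" using W in_W unfolding abs_convex_def by blast
    moreover have "g ?w = 0" using g in_W by (simp add: dlinear_on_def)
    ultimately have "h ?w \<le> \<epsilon>" using small abs_le_D1 by blast
    moreover have "h ?w = (g \<mu> * h \<nu> - g \<nu> * h \<mu>) / s"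
      using h in_W by (simp add: dlinear_on_def diff_divide_distrib)
    ultimately have "g \<mu> * h \<nu> - g \<nu> * h \<mu> \<le> \<epsilon> * (g \<nu> + g \<mu>)"
      using s by (simp add: field_simps s_def)
    then show ?thesis using pos by (simp add: field_simps)
  qed
  define c where "c = (SUP \<nu>\<in>P. (h \<nu> - \<epsilon>) / g \<nu>)"
  have ne: "P \<noteq> {}" using True by (auto simp: P_def)
  then obtain \<mu>0 where \<mu>0: "\<mu>0 \<in> P" by blast
  have P: "\<bar>h \<phi> - c * g \<phi>\<bar> \<le> \<epsilon>" if \<phi>: "\<phi> \<in> P" for \<phi>
  proof -
    have "bdd_above ((\<lambda>\<nu>. (h \<nu> - \<epsilon>) / g \<nu>) ` P)"
      using cross[OF _ \<mu>0] by (rule bdd_aboveI2)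
    then have "(h \<phi> - \<epsilon>) / g \<phi> \<le> c" unfolding c_def using \<phi> by (intro cSUP_upper)
    moreover have "c \<le> (h \<phi> + \<epsilon>) / g \<phi>"
      unfolding c_def using ne cross[OF _ \<phi>] by (rule cSUP_least)
    moreover have "g \<phi> > 0" using \<phi> by (simp add: P_def)
    ultimately have "h \<phi> - \<epsilon> \<le> c * g \<phi>" "c * g \<phi> \<le> h \<phi> + \<epsilon>" by (simp_all add: field_simps)
    then show ?thesis by linarith
  qed
  have "\<bar>h \<phi> - c * g \<phi>\<bar> \<le> \<epsilon>" if \<phi>: "\<phi> \<in> W" for \<phi>
  proof -
    consider "g \<phi> > 0" | "g \<phi> = 0" | "g \<phi> < 0" by linarith
    then show ?thesis
    proof cases
      case 1
      then show ?thesis using P \<phi> by (simp add: P_def)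
    next
      case 2
      then show ?thesis using small \<phi> by simp
    next
      case 3
      let ?m = "dlin F (-1) \<phi> 0 \<phi>"
      have "?m \<in> W" using W \<phi> unfolding abs_convex_def by simp
      moreover have "g ?m = - g \<phi>" "h ?m = - h \<phi>" using g h \<phi> by (simp_all add: dlinear_on_def)
      ultimately show ?thesis using P[of ?m] 3 by (simp add: P_def abs_minus_commute)
    qed
  qed
  then show ?thesis by blast
qed

text \<open>Induction on the number of functions: on the common kernel of the first \<open>m\<close>
  the one-dimensional step yields a coefficient for \<open>g m\<close>, and the induction hypothesis
  is applied on all of \<open>W\<close> to \<open>h\<close> minus that multiple.\<close>

lemma small_on_kernels_imp_close:
  fixes g :: "nat \<Rightarrow> ((kpt \<Rightarrow> real) \<Rightarrow> real) \<Rightarrow> real"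
  assumes W: "abs_convex F W" and h: "dlinear_on F W h" and g: "\<And>i. dlinear_on F W (g i)"
    and small: "\<And>\<phi>. \<phi> \<in> W \<Longrightarrow> (\<forall>i<m. g i \<phi> = 0) \<Longrightarrow> \<bar>h \<phi>\<bar> \<le> \<epsilon>"
  shows "\<exists>c. \<forall>\<phi>\<in>W. \<bar>h \<phi> - (\<Sum>i<m. c i * g i \<phi>)\<bar> \<le> \<epsilon>"
  using h small
proof (induction m arbitrary: h)
  case 0
  then show ?case by simp
next
  case (Suc m)
  define V where "V = {\<phi> \<in> W. \<forall>i<m. g i \<phi> = 0}"
  have "\<exists>c. \<forall>\<phi>\<in>V. \<bar>h \<phi> - c * g m \<phi>\<bar> \<le> \<epsilon>"
  proof (rule small_on_kernel_imp_close)
    show "abs_convex F V" using W g unfolding abs_convex_def V_def by (simp add: dlinear_on_def)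
    show "dlinear_on F V h" "dlinear_on F V (g m)"
      using Suc.prems(1) g[of m] by (auto simp: dlinear_on_def V_def)
    show "\<bar>h \<phi>\<bar> \<le> \<epsilon>" if "\<phi> \<in> V" "g m \<phi> = 0" for \<phi>
      using that by (intro Suc.prems(2)) (auto simp: V_def less_Suc_eq)
  qed
  then obtain b where b: "\<And>\<phi>. \<phi> \<in> V \<Longrightarrow> \<bar>h \<phi> - b * g m \<phi>\<bar> \<le> \<epsilon>" by blast
  have "\<exists>c. \<forall>\<phi>\<in>W. \<bar>(h \<phi> - b * g m \<phi>) - (\<Sum>i<m. c i * g i \<phi>)\<bar> \<le> \<epsilon>"
  proof (rule Suc.IH)
    show "dlinear_on F W (\<lambda>\<phi>. h \<phi> - b * g m \<phi>)"
      using Suc.prems(1) g[of m] by (simp add: dlinear_on_def algebra_simps)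
  qed (use b in \<open>simp add: V_def\<close>)
  then obtain c where c: "\<And>\<phi>. \<phi> \<in> W \<Longrightarrow> \<bar>(h \<phi> - b * g m \<phi>) - (\<Sum>i<m. c i * g i \<phi>)\<bar> \<le> \<epsilon>" by blast
  have "(\<Sum>i<Suc m. (c(m := b)) i * g i \<phi>) = b * g m \<phi> + (\<Sum>i<m. c i * g i \<phi>)" for \<phi>
    by (simp add: add.commute)
  then show ?case using c by (intro exI[of _ "c(m := b)"]) (simp add: algebra_simps)
qed

lemma dlinear_on_eval: "f \<in> CK F \<Longrightarrow> dlinear_on F W (\<lambda>\<phi>. \<phi> f)"
  by (simp add: dlinear_on_def)

section \<open>Weak* sequential continuity of the coordinate at infinity and its
  approximation\<close>

definition test_fun :: "nat set set \<Rightarrow> nat \<Rightarrow> kpt \<Rightarrow> real" where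
  "test_fun F i = (case i of 0 \<Rightarrow> one_fun F | Suc n \<Rightarrow> unit_at n)"

text \<open>The assumption is claim (i) with a witness: for each sequence in
  \<open>\<ell>\<^sub>1\<close> some continuous function refutes convergence to evaluation at
  infinity. Claim (ii) is derived from it here.\<close>

locale ad_family_without_sequence = covering_ad_family +
  assumes no_sequence: "\<And>lam :: nat \<Rightarrow> nat \<Rightarrow> real. (\<And>k. summable (\<lambda>n. \<bar>lam k n\<bar>)) \<Longrightarrow>
    \<exists>f\<in>CK F. \<not> (\<lambda>k. \<Sum>n. lam k n * f (Pt n)) \<longlonglongrightarrow> f Infty"
begin

lemma test_fun_CK [simp]: "test_fun F i \<in> CK F"
  by (simp add: test_fun_def split: nat.split)

text \<open>The series and the coordinate at infinity are both computed from the values on the test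
  functions.\<close>

lemma vanishing_tests_imp_zero:
  assumes "\<phi> \<in> ell1_infty F" "\<And>i. \<phi> (test_fun F i) = 0" "f \<in> CK F"
  shows "\<phi> f = 0"
proof -
  have "\<phi> (one_fun F) = 0" "\<phi> (unit_at n) = 0" for n
    using assms(2)[of 0] assms(2)[of "Suc n"] by (simp_all add: test_fun_def)
  then show ?thesis using assms by (simp add: ell1_infty_def atomic_part_def infty_coord_def)
qed

text \<open>Dividing \<open>\<phi> m\<close> by its coordinate at infinity gives
  \<open>\<delta>_\<infinity>\<close> minus the element of \<open>\<ell>\<^sub>1\<close> with
  coefficients \<open>lam m\<close>. Since the divisors stay away from 0, the quotients are still
  weak* null, so \<open>lam\<close> would converge to \<open>\<delta>_\<infinity>\<close>.\<close>

lemma infty_coord_null_sequence: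
  assumes \<phi>: "\<And>m. \<phi> m \<in> ell1_infty F" and null: "\<And>f. f \<in> CK F \<Longrightarrow> (\<lambda>m. \<phi> m f) \<longlonglongrightarrow> 0"
    and "\<epsilon> > 0" and big: "\<And>m. \<bar>infty_coord F (\<phi> m)\<bar> > \<epsilon>"
  shows False
proof -
  let ?h = "\<lambda>m. infty_coord F (\<phi> m)"
  define lam where "lam m n = - (\<phi> m (unit_at n) / ?h m)" for m n
  have d: "\<phi> m \<in> dualC F" for m using \<phi> by (auto simp: ell1_infty_def)
  have "summable (\<lambda>n. \<bar>lam m n\<bar>)" for m
    unfolding lam_def using summable_divide[OF dualC_unit_summable(1)[OF d], of m "\<bar>?h m\<bar>"] by simp
  then obtain f where f: "f \<in> CK F" and nf: "\<not> (\<lambda>k. \<Sum>n. lam k n * f (Pt n)) \<longlonglongrightarrow> f Infty"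
    using no_sequence by blast
  have eq: "(\<Sum>n. lam m n * f (Pt n)) = f Infty - \<phi> m f / ?h m" for m
  proof -
    have "?h m \<noteq> 0" using big[of m] \<open>\<epsilon> > 0\<close> by auto
    have "(\<Sum>n. lam m n * f (Pt n)) = (\<Sum>n. (- 1 / ?h m) * (\<phi> m (unit_at n) * f (Pt n)))"
      by (simp add: lam_def)
    also have "\<dots> = (- 1 / ?h m) * (\<Sum>n. \<phi> m (unit_at n) * f (Pt n))"
      by (rule suminf_mult[OF dualC_atomic_summable[OF d f]])
    also have "(\<Sum>n. \<phi> m (unit_at n) * f (Pt n)) = \<phi> m f - ?h m * f Infty"
      using ell1_inftyD(2)[OF \<phi>[of m] f] by (simp add: atomic_part_def)
    finally show ?thesis using \<open>?h m \<noteq> 0\<close> by (simp add: field_simps)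
  qed
  have "(\<lambda>m. \<phi> m f / ?h m) \<longlonglongrightarrow> 0"
  proof (rule tendsto_rabs_zero_cancel,
      rule tendsto_sandwich[where f = "\<lambda>_. 0" and h = "\<lambda>m. \<bar>\<phi> m f\<bar> / \<epsilon>"])
    show "(\<lambda>m. \<bar>\<phi> m f\<bar> / \<epsilon>) \<longlonglongrightarrow> 0"
      using tendsto_divide[OF tendsto_rabs_zero[OF null[OF f]] tendsto_const[of \<epsilon>]] \<open>\<epsilon> > 0\<close> by simp
    show "\<forall>\<^sub>F m in sequentially. \<bar>\<phi> m f / ?h m\<bar> \<le> \<bar>\<phi> m f\<bar> / \<epsilon>"
    proof (rule always_eventually, rule allI)
      fix m
      have "\<epsilon> \<le> \<bar>?h m\<bar>" "0 < \<bar>?h m\<bar> * \<epsilon>" using big[of m] \<open>\<epsilon> > 0\<close> by auto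
      then show "\<bar>\<phi> m f / ?h m\<bar> \<le> \<bar>\<phi> m f\<bar> / \<epsilon>"
        unfolding abs_divide by (intro divide_left_mono) auto
    qed
  qed auto
  then have "(\<lambda>m. f Infty - \<phi> m f / ?h m) \<longlonglongrightarrow> f Infty - 0" by (intro tendsto_intros)
  then show False using nf by (simp add: eq)
qed

text \<open>Countably many test functions separate the points of \<open>ell1_infty\<close>, hence control convergence on compact sets.\<close>
lemma compact_vanishing_tests_null:
  assumes W: "compactin (weak_star F) W" "W \<subseteq> ell1_infty F"
    and \<phi>: "\<And>m. \<phi> m \<in> W" "\<And>m i. i < m \<Longrightarrow> \<phi> m (test_fun F i) = 0" and f: "f \<in> CK F"
  shows "(\<lambda>m. \<phi> m f) \<longlonglongrightarrow> 0"
proof (rule ccontr)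
  assume "\<not> (\<lambda>m. \<phi> m f) \<longlonglongrightarrow> 0"
  then obtain e where e: "e > 0" "\<And>N. \<exists>m\<ge>N. \<bar>\<phi> m f\<bar> \<ge> e"
    unfolding LIMSEQ_def by (auto simp: dist_real_def not_less)
  let ?X = "subtopology (weak_star F) W"
  have top: "topspace ?X = W" using compactin_subset_topspace[OF W(1)] by auto
  \<comment> \<open>Nested closed subsets of the compact set \<open>W\<close>; the \<open>m\<close>
    test conditions are merged into one vanishing sum to be a single closed preimage. A point common
    to all of them vanishes on every test function but not at \<open>f\<close>.\<close>
  define C where "C m = {\<psi> \<in> topspace ?X. \<bar>\<psi> f\<bar> \<in> {e..}} \<inter>
      {\<psi> \<in> topspace ?X. (\<Sum>i<m. \<bar>\<psi> (test_fun F i)\<bar>) \<in> {0}}" for m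
  have C: "\<psi> \<in> C m \<longleftrightarrow> \<psi> \<in> W \<and> \<bar>\<psi> f\<bar> \<ge> e \<and> (\<forall>i<m. \<psi> (test_fun F i) = 0)" for m \<psi>
    unfolding C_def top by (auto simp: sum_nonneg_eq_0_iff)
  have "(\<Inter>m. C m) \<noteq> {}"
  proof (rule compact_space_imp_nest)
    show "compact_space ?X" using W(1) by (rule compact_space_subtopology)
    have ev: "continuous_map ?X euclideanreal (\<lambda>\<psi>. \<psi> u)" if "u \<in> CK F" for u
      using continuous_map_eval[OF that] by (rule continuous_map_from_subtopology)
    show "closedin ?X (C m)" for m
      unfolding C_def
    proof (rule closedin_Int)
      show "closedin ?X {\<psi> \<in> topspace ?X. \<bar>\<psi> f\<bar> \<in> {e..}}"
        by (rule closedin_continuous_map_preimage[where Y = euclideanreal])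
          (auto intro!: continuous_map_real_abs ev f)
      show "closedin ?X {\<psi> \<in> topspace ?X. (\<Sum>i<m. \<bar>\<psi> (test_fun F i)\<bar>) \<in> {0}}"
        by (rule closedin_continuous_map_preimage[where Y = euclideanreal])
          (auto intro!: continuous_map_sum continuous_map_real_abs ev)
    qed
    show "C m \<noteq> {}" for m
    proof -
      obtain k where k: "k \<ge> m" "\<bar>\<phi> k f\<bar> \<ge> e" using e(2) by blast
      then have "\<phi> k \<in> C m" using \<phi> by (simp add: C)
      then show ?thesis by blast
    qed
    show "decseq C" unfolding decseq_def by (auto simp: C)
  qed
  then obtain \<psi> where \<psi>: "\<And>m. \<psi> \<in> C m" by blast
  have "\<psi> f = 0"
  proof (rule vanishing_tests_imp_zero[OF _ _ f])
    show "\<psi> \<in> ell1_infty F" using \<psi>[of 0] W(2) by (auto simp: C)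
    show "\<psi> (test_fun F i) = 0" for i using \<psi>[of "Suc i"] by (simp add: C)
  qed
  then show False using \<psi>[of 0] e(1) by (simp add: C)
qed

text \<open>Were no finite number of tests enough to make the coordinate small on \<open>W\<close>,
  the counterexamples would form a weak* null sequence with coordinates bounded away from 0.
  Finitely many tests therefore suffice, and Hahn-Banach turns them into a combination.\<close>

lemma infty_coord_approximable:
  assumes W: "W \<in> mackey_sets F (ell1_infty F)" and "\<epsilon> > 0"
  shows "\<exists>x\<in>CK F. \<forall>\<phi>\<in>W. \<bar>\<phi> x - infty_coord F \<phi>\<bar> \<le> \<epsilon>"
proof -
  have ac: "abs_convex F W" and cp: "compactin (weak_star F) W" and sub: "W \<subseteq> ell1_infty F"
    and ne: "W \<noteq> {}"
    using W by (auto simp: mackey_sets_def)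
  have d: "\<phi> \<in> dualC F" if "\<phi> \<in> W" for \<phi> using that sub by (auto simp: ell1_infty_def)
  have "\<exists>m. \<forall>\<phi>\<in>W. (\<forall>i<m. \<phi> (test_fun F i) = 0) \<longrightarrow> \<bar>infty_coord F \<phi>\<bar> \<le> \<epsilon>"
  proof (rule ccontr)
    assume "\<not> ?thesis"
    then have "\<forall>m. \<exists>\<phi>. \<phi> \<in> W \<and> (\<forall>i<m. \<phi> (test_fun F i) = 0) \<and> \<bar>infty_coord F \<phi>\<bar> > \<epsilon>"
      by (simp add: not_le) blast
    then obtain \<phi> where \<phi>: "\<And>m. \<phi> m \<in> W" "\<And>m i. i < m \<Longrightarrow> \<phi> m (test_fun F i) = 0"
        "\<And>m. \<bar>infty_coord F (\<phi> m)\<bar> > \<epsilon>"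
      by metis
    have "(\<lambda>m. \<phi> m f) \<longlonglongrightarrow> 0" if "f \<in> CK F" for f
      using compact_vanishing_tests_null[OF cp sub \<phi>(1,2) that] .
    then show False using infty_coord_null_sequence[of \<phi> \<epsilon>] \<phi> sub \<open>\<epsilon> > 0\<close> by blast
  qed
  then obtain m where m: "\<And>\<phi>. \<phi> \<in> W \<Longrightarrow> \<forall>i<m. \<phi> (test_fun F i) = 0 \<Longrightarrow> \<bar>infty_coord F \<phi>\<bar> \<le> \<epsilon>"
    by blast
  have "dlinear_on F W (infty_coord F)" using d by (simp add: dlinear_on_def infty_coord_lin)
  then have "\<exists>c. \<forall>\<phi>\<in>W. \<bar>infty_coord F \<phi> - (\<Sum>i<m. c i * \<phi> (test_fun F i))\<bar> \<le> \<epsilon>"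
    by (rule small_on_kernels_imp_close[OF ac _ dlinear_on_eval[OF test_fun_CK] m])
  then obtain c where c: "\<forall>\<phi>\<in>W. \<bar>infty_coord F \<phi> - (\<Sum>i<m. c i * \<phi> (test_fun F i))\<bar> \<le> \<epsilon>" ..
  let ?x = "\<lambda>t. \<Sum>i<m. c i * test_fun F i t"
  \<comment> \<open>An element of \<open>W\<close> is needed only because \<open>dualC_sum\<close>
    carries a functional as a parameter.\<close>
  obtain \<phi>0 where "\<phi>0 \<in> W" using ne by blast
  from dualC_sum(1)[OF d[OF this] test_fun_CK] have "?x \<in> CK F" .
  moreover have "\<bar>\<phi> ?x - infty_coord F \<phi>\<bar> \<le> \<epsilon>" if "\<phi> \<in> W" for \<phi>
    using bspec[OF c that] by (simp add: dualC_sum(2)[OF d[OF that] test_fun_CK] abs_minus_commute)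
  ultimately show ?thesis by blast
qed

section \<open>A Mackey Cauchy filter without a limit\<close>

lemma mackey_sets_directed:
  assumes W: "W \<in> mackey_sets F (ell1_infty F)" and V: "V \<in> mackey_sets F (ell1_infty F)"
  shows "\<exists>U\<in>mackey_sets F (ell1_infty F). W \<subseteq> U \<and> V \<subseteq> U"
proof -
  let ?s = "\<lambda>(\<phi>, \<psi>). dlin F 1 \<phi> 1 \<psi>"
  let ?U = "?s ` (W \<times> V)"
  have Wd: "\<phi> \<in> extensional (CK F)" if "\<phi> \<in> W \<or> \<phi> \<in> V" for \<phi>
    using that W V by (auto simp: mackey_sets_def ell1_infty_def dualC_def)
  \<comment> \<open>Absolute convexity with both coefficients 0 puts the zero functional into each
    set; hence the sum of the two sets contains both and serves as upper bound.\<close>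
  have zero: "\<exists>z\<in>A. \<forall>f\<in>CK F. z f = 0" if "A \<in> mackey_sets F (ell1_infty F)" for A
  proof -
    have "A \<noteq> {}" using that by (simp add: mackey_sets_def)
    then obtain \<phi> where "\<phi> \<in> A" by blast
    then have "dlin F 0 \<phi> 0 \<phi> \<in> A" using that by (simp add: mackey_sets_def abs_convex_def)
    then show ?thesis by (rule bexI[rotated]) simp
  qed
  have "W \<subseteq> ?U"
  proof
    fix \<phi> assume \<phi>: "\<phi> \<in> W"
    obtain z where z: "z \<in> V" "\<forall>f\<in>CK F. z f = 0" using zero[OF V] by blast
    have "\<phi> = dlin F 1 \<phi> 1 z"
      by (rule extensionalityI[of _ "CK F"]) (use Wd \<phi> z in \<open>auto simp: dlin_def\<close>)
    then show "\<phi> \<in> ?U" using \<phi> z by force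
  qed
  moreover have "V \<subseteq> ?U"
  proof
    fix \<phi> assume \<phi>: "\<phi> \<in> V"
    obtain z where z: "z \<in> W" "\<forall>f\<in>CK F. z f = 0" using zero[OF W] by blast
    have "\<phi> = dlin F 1 z 1 \<phi>"
      by (rule extensionalityI[of _ "CK F"]) (use Wd \<phi> z in \<open>auto simp: dlin_def\<close>)
    then show "\<phi> \<in> ?U" using \<phi> z by force
  qed
  moreover have "?U \<in> mackey_sets F (ell1_infty F)"
    unfolding mackey_sets_def mem_Collect_eq
  proof (intro conjI)
    show "?U \<noteq> {}" using W V by (auto simp: mackey_sets_def)
    show "?U \<subseteq> ell1_infty F"
    proof -
      have "dlin F 1 \<phi> 1 \<psi> \<in> ell1_infty F" if "\<phi> \<in> W" "\<psi> \<in> V" for \<phi> \<psi>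
      proof -
        have "\<phi> \<in> ell1_infty F" "\<psi> \<in> ell1_infty F" using that W V by (auto simp: mackey_sets_def)
        then show ?thesis using dual_subspace_ell1_infty by (simp add: dual_subspace_def)
      qed
      then show ?thesis by auto
    qed
    show "compactin (weak_star F) ?U"
      using W V by (intro compactin_sum) (auto simp: mackey_sets_def)
    show "abs_convex F ?U"
      unfolding abs_convex_def
    proof (intro ballI allI impI)
      fix \<phi> \<psi> a b assume "\<phi> \<in> ?U" "\<psi> \<in> ?U" and ab: "\<bar>a\<bar> + \<bar>b\<bar> \<le> (1 :: real)"
      then obtain \<phi>1 \<phi>2 \<psi>1 \<psi>2 where *: "\<phi>1 \<in> W" "\<psi>1 \<in> W" "\<phi>2 \<in> V" "\<psi>2 \<in> V"
        "\<phi> = dlin F 1 \<phi>1 1 \<phi>2" "\<psi> = dlin F 1 \<psi>1 1 \<psi>2" by auto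
      have "dlin F a \<phi> b \<psi> = dlin F 1 (dlin F a \<phi>1 b \<psi>1) 1 (dlin F a \<phi>2 b \<psi>2)"
        unfolding *(5,6) by (auto simp: dlin_def algebra_simps restrict_def)
      moreover have "dlin F a \<phi>1 b \<psi>1 \<in> W" "dlin F a \<phi>2 b \<psi>2 \<in> V"
        using W V * ab by (auto simp: mackey_sets_def abs_convex_def)
      ultimately show "dlin F a \<phi> b \<psi> \<in> ?U" by force
    qed
  qed
  ultimately show ?thesis by blast
qed

text \<open>Through these segments, Mackey convergence implies convergence at each natural number
  and at infinity.\<close>

lemma delta_mackey_set:
  assumes "x = Pt n \<or> x = Infty"
  shows "(\<lambda>t. delta F t x) ` {-1..1} \<in> mackey_sets F (ell1_infty F)"
  unfolding mackey_sets_def mem_Collect_eq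
proof (intro conjI)
  show "(\<lambda>t. delta F t x) ` {-1..1} \<noteq> {}" by simp
  show "(\<lambda>t. delta F t x) ` {-1..1} \<subseteq> ell1_infty F" using delta_ell1_infty(1)[OF assms] by blast
  show "compactin (weak_star F) ((\<lambda>t. delta F t x) ` {-1..1})"
    using assms by (intro compactin_delta) auto
  show "abs_convex F ((\<lambda>t. delta F t x) ` {-1..1})"
    unfolding abs_convex_def
  proof (intro ballI allI impI)
    fix \<phi> \<psi> a b
    assume "\<phi> \<in> (\<lambda>t. delta F t x) ` {-1..1}" "\<psi> \<in> (\<lambda>t. delta F t x) ` {-1..1}"
      and ab: "\<bar>a\<bar> + \<bar>b\<bar> \<le> (1 :: real)"
    then obtain s t where st: "\<bar>s\<bar> \<le> 1" "\<bar>t\<bar> \<le> 1" "\<phi> = delta F s x" "\<psi> = delta F t x"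
      by (auto simp: abs_le_iff)
    have "dlin F a \<phi> b \<psi> = delta F (a * s + b * t) x"
      unfolding st by (auto simp: dlin_def delta_def algebra_simps restrict_def)
    moreover have "\<bar>a * s + b * t\<bar> \<le> 1"
    proof -
      have "\<bar>a * s + b * t\<bar> \<le> \<bar>a\<bar> * \<bar>s\<bar> + \<bar>b\<bar> * \<bar>t\<bar>"
        using abs_triangle_ineq[of "a * s" "b * t"] by (simp add: abs_mult)
      also have "\<dots> \<le> \<bar>a\<bar> * 1 + \<bar>b\<bar> * 1" using st by (intro add_mono mult_left_mono) auto
      finally show ?thesis using ab by simp
    qed
    ultimately show "dlin F a \<phi> b \<psi> \<in> (\<lambda>t. delta F t x) ` {-1..1}"
      by (auto simp: abs_le_iff intro!: image_eqI)
  qed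
qed

lemma bdd_above_mackey_set:
  assumes W: "W \<in> mackey_sets F (ell1_infty F)" and z: "z \<in> CK F"
  shows "bdd_above ((\<lambda>\<phi>. \<bar>\<phi> z\<bar>) ` W)"
proof -
  have "compactin euclideanreal ((\<lambda>\<phi>. \<bar>\<phi> z\<bar>) ` W)"
    by (rule image_compactin[where X = "weak_star F"])
      (use W z in \<open>auto simp: mackey_sets_def intro!: continuous_map_real_abs continuous_map_eval\<close>)
  then have "compact ((\<lambda>\<phi>. \<bar>\<phi> z\<bar>) ` W)" by simp
  then show ?thesis by (simp add: compact_imp_bounded bounded_imp_bdd_above)
qed

text \<open>A limit of the filter would take at each of these points the coordinate of its
  evaluation: 0 at every natural number and 1 at infinity. Density of the naturals excludes such a
  continuous function.\<close>

lemma not_mackey_complete_ell1_infty: "\<not> mackey_complete F (ell1_infty F)"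
proof
  assume complete: "mackey_complete F (ell1_infty F)"
  let ?M = "mackey_sets F (ell1_infty F)"
  define A where "A = (\<lambda>(W, \<epsilon>). {x \<in> CK F. \<forall>\<phi>\<in>W. \<bar>\<phi> x - infty_coord F \<phi>\<bar> \<le> \<epsilon>})"
  define I where "I = ?M \<times> {0::real<..}"
  \<comment> \<open>The sets \<open>A (W, \<epsilon>)\<close> are nonempty by
    \<open>infty_coord_approximable\<close> and form a filter base by
    \<open>mackey_sets_directed\<close>.\<close>
  define \<F> where "\<F> = (INF i\<in>I. principal (A i))"
  have Ine: "I \<noteq> {}" using delta_mackey_set[of Infty] by (force simp: I_def)
  have ev: "eventually P \<F> \<longleftrightarrow> (\<exists>i\<in>I. \<forall>x\<in>A i. P x)" for P
    unfolding \<F>_def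
  proof (subst eventually_INF_base[OF Ine])
    fix i j assume "i \<in> I" "j \<in> I"
    then obtain W V d e where i: "i = (W, d)" "j = (V, e)" "W \<in> ?M" "V \<in> ?M" "d > 0" "e > 0"
      by (auto simp: I_def)
    obtain U where "U \<in> ?M" "W \<subseteq> U" "V \<subseteq> U" using mackey_sets_directed[OF i(3,4)] by blast
    then have "(U, min d e) \<in> I" "A (U, min d e) \<subseteq> A i \<inter> A j"
      using i by (auto simp: I_def A_def)
    then show "\<exists>k\<in>I. principal (A k) \<le> inf (principal (A i)) (principal (A j))"
      by (intro bexI[of _ "(U, min d e)"]) auto
  qed (simp add: eventually_principal)
  have A_ne: "A i \<noteq> {}" if "i \<in> I" for i
    using infty_coord_approximable that by (fastforce simp: I_def A_def)
  have nb: "\<F> \<noteq> bot"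
    unfolding trivial_limit_def ev using A_ne by blast
  have in_CK: "eventually (\<lambda>z. z \<in> CK F) \<F>"
    unfolding ev using Ine by (auto simp: A_def)
  have cauchy: "\<forall>W\<in>?M. \<forall>\<epsilon>>0. \<exists>B. eventually (\<lambda>z. z \<in> B) \<F> \<and>
      (\<forall>x\<in>B. \<forall>y\<in>B. mseminorm W (\<lambda>t. x t - y t) < \<epsilon>)"
  proof (intro ballI allI impI)
    fix W and \<epsilon> :: real assume W: "W \<in> ?M" and "\<epsilon> > 0"
    \<comment> \<open>Two approximations within a third of \<open>\<epsilon>\<close> differ by at
      most two thirds, which keeps the inequality strict after taking the supremum.\<close>
    have "mseminorm W (\<lambda>t. x t - y t) < \<epsilon>" if "x \<in> A (W, \<epsilon> / 3)" "y \<in> A (W, \<epsilon> / 3)" for x y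
    proof -
      have "mseminorm W (\<lambda>t. x t - y t) \<le> 2 * \<epsilon> / 3"
        unfolding mseminorm_def
      proof (rule cSUP_least)
        show "W \<noteq> {}" using W by (auto simp: mackey_sets_def)
        fix \<phi> assume \<phi>: "\<phi> \<in> W"
        then have "\<phi> \<in> dualC F" using W by (auto simp: mackey_sets_def ell1_infty_def)
        then have "\<phi> (\<lambda>t. x t - y t) = \<phi> x - \<phi> y" using that by (intro dualC_diff) (auto simp: A_def)
        moreover have "\<bar>\<phi> x - infty_coord F \<phi>\<bar> \<le> \<epsilon> / 3" "\<bar>\<phi> y - infty_coord F \<phi>\<bar> \<le> \<epsilon> / 3"
          using that \<phi> by (auto simp: A_def)
        ultimately show "\<bar>\<phi> (\<lambda>t. x t - y t)\<bar> \<le> 2 * \<epsilon> / 3" by linarith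
      qed
      then show ?thesis using \<open>\<epsilon> > 0\<close> by linarith
    qed
    moreover have "eventually (\<lambda>z. z \<in> A (W, \<epsilon> / 3)) \<F>"
      unfolding ev using W \<open>\<epsilon> > 0\<close> by (intro bexI[of _ "(W, \<epsilon> / 3)"]) (auto simp: I_def)
    ultimately show "\<exists>B. eventually (\<lambda>z. z \<in> B) \<F> \<and>
        (\<forall>x\<in>B. \<forall>y\<in>B. mseminorm W (\<lambda>t. x t - y t) < \<epsilon>)" by blast
  qed
  have "\<exists>z\<in>CK F. \<forall>W\<in>?M. \<forall>\<epsilon>>0. eventually (\<lambda>x. mseminorm W (\<lambda>t. x t - z t) < \<epsilon>) \<F>"
    by (rule complete[unfolded mackey_complete_def, THEN spec, THEN mp])
      (intro conjI nb in_CK cauchy)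
  then obtain z where z: "z \<in> CK F"
    and lim: "\<forall>W\<in>?M. \<forall>\<epsilon>>0. eventually (\<lambda>x. mseminorm W (\<lambda>t. x t - z t) < \<epsilon>) \<F>" ..
  have val: "z x = (if x = Infty then 1 else 0)" if x: "x = Pt n \<or> x = Infty" for x n
  proof -
    let ?W = "(\<lambda>t. delta F t x) ` {-1..1}"
    let ?v = "if x = Infty then 1 else 0 :: real"
    have W: "?W \<in> ?M" using x by (rule delta_mackey_set)
    have mem: "delta F 1 x \<in> ?W" by simp
    have "\<bar>z x - ?v\<bar> \<le> 0 + e" if "e > 0" for e
    proof -
      have e2: "e / 2 > 0" using that by simp
      have "eventually (\<lambda>y. y \<in> A (?W, e / 2)) \<F>"
        unfolding ev using W e2 by (intro bexI[of _ "(?W, e / 2)"]) (auto simp: I_def)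
      with lim[rule_format, OF W e2] have "eventually (\<lambda>y. mseminorm ?W (\<lambda>t. y t - z t) < e / 2 \<and> y \<in> A (?W, e / 2)) \<F>"
        by (rule eventually_conj)
      then obtain y where y: "mseminorm ?W (\<lambda>t. y t - z t) < e / 2" "y \<in> A (?W, e / 2)"
        using eventually_happens'[OF nb] by blast
      from y(2) have yC: "y \<in> CK F" and "\<forall>\<phi>\<in>?W. \<bar>\<phi> y - infty_coord F \<phi>\<bar> \<le> e / 2"
        unfolding A_def split_conv mem_Collect_eq by blast+
      with mem have "\<bar>delta F 1 x y - infty_coord F (delta F 1 x)\<bar> \<le> e / 2" by blast
      with yC have "\<bar>y x - ?v\<bar> \<le> e / 2" by (simp add: delta_ell1_infty(2)[OF x])
      moreover have "\<bar>y x - z x\<bar> < e / 2"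
      proof -
        have dC: "(\<lambda>t. y t - z t) \<in> CK F" using yC z by (rule CK_diff)
        have "\<bar>delta F 1 x (\<lambda>t. y t - z t)\<bar> \<le> mseminorm ?W (\<lambda>t. y t - z t)"
          unfolding mseminorm_def by (rule cSUP_upper[OF mem bdd_above_mackey_set[OF W dC]])
        then show ?thesis using y dC by simp
      qed
      ultimately show ?thesis by linarith
    qed
    then have "\<bar>z x - ?v\<bar> \<le> 0" by (rule field_le_epsilon)
    then show ?thesis by simp
  qed
  have "\<bar>z Infty\<bar> \<le> 0"
    by (rule abs_le_of_nat_points[OF z]) (use val in auto)
  then show False using val[of Infty] by simp
qed

lemma not_fully_mackey_complete: "\<not> fully_mackey_complete F"
  using not_mackey_complete_ell1_infty dual_subspace_ell1_infty norming_ell1_infty norm_closed_ell1_infty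
  unfolding fully_mackey_complete_def by blast

end

theorem theorem4p10:
  assumes "continuum_hypothesis"
  shows "\<exists>F. maximal_ad_family F \<and>
     \<not> (\<exists>lam :: nat \<Rightarrow> nat \<Rightarrow> real. (\<forall>k. summable (\<lambda>n. \<bar>lam k n\<bar>)) \<and>
          (\<forall>f\<in>CK F. (\<lambda>k. \<Sum>n. lam k n * f (Pt n)) \<longlonglongrightarrow> f Infty)) \<and>
     \<not> fully_mackey_complete F"
proof -
  obtain G where G: "almost_disjoint_family G" "\<Union>G = UNIV" "\<And>lam. \<not> tends_to_infty lam G"
    using exists_ad_family_killing_sequences[OF assms] by blast
  obtain F where F: "maximal_ad_family F" "G \<subseteq> F" using maximal_ad_extension[OF G(1)] .
  interpret covering_ad_family F
  proof
    show "almost_disjoint_family F" using F(1) by (simp add: maximal_ad_family_def)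
    show "\<Union>F = UNIV" using G(2) F(2) Union_mono[of G F] by auto
  qed
  have no: "\<exists>f\<in>CK F. \<not> (\<lambda>k. \<Sum>n. lam k n * f (Pt n)) \<longlonglongrightarrow> f Infty"
    if s: "\<And>k. summable (\<lambda>n. \<bar>lam k n\<bar>)" for lam :: "nat \<Rightarrow> nat \<Rightarrow> real"
  proof (rule ccontr)
    assume "\<not> ?thesis"
    then have conv: "(\<lambda>k. \<Sum>n. lam k n * f (Pt n)) \<longlonglongrightarrow> f Infty" if "f \<in> CK F" for f
      using that by blast
    have "(\<lambda>k. lam k n) \<longlonglongrightarrow> 0" for n
    proof -
      have "(\<Sum>m. lam k m * unit_at n (Pt m)) = lam k n" for k
        by (subst suminf_finite[of "{n}"]) (auto simp: unit_at_def indicator_def)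
      then show ?thesis using conv[OF unit_at_CK[of n]] by (simp add: unit_at_def[of n])
    qed
    moreover have "(\<lambda>k. \<Sum>n. lam k n) \<longlonglongrightarrow> 1"
      using conv[OF one_fun_CK] by (simp add: one_fun_def)
    moreover have "(\<lambda>k. mass (lam k) N) \<longlonglongrightarrow> 0" if "N \<in> G" for N
    proof -
      have "indicator (insert (Ult N) (Pt ` N)) (Pt n) = (indicator N n :: real)" for n
        by (auto simp: indicator_def)
      moreover have "indicator (insert (Ult N) (Pt ` N)) Infty = (0 :: real)" by (auto simp: indicator_def)
      moreover have "N \<in> F" using that F(2) by blast
      ultimately show ?thesis
        using conv[OF member_indicator_CK[of N]] by (simp add: mass_def)
    qed
    ultimately have "tends_to_infty lam G" using s by (simp add: tends_to_infty_def)
    then show False using G(3) by blast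
  qed
  interpret ad_family_without_sequence F
    by unfold_locales (rule no)
  have "\<not> (\<exists>lam :: nat \<Rightarrow> nat \<Rightarrow> real. (\<forall>k. summable (\<lambda>n. \<bar>lam k n\<bar>)) \<and>
          (\<forall>f\<in>CK F. (\<lambda>k. \<Sum>n. lam k n * f (Pt n)) \<longlonglongrightarrow> f Infty))"
    using no by blast
  then show ?thesis using F(1) not_fully_mackey_complete by blast
qed

end
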